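(* Let $(\mathcal C,\mathbb E,\mathfrak s)$ be an extriangulated category. Any morphism of $\mathbb E$-triangles in $\mathcal C$ is a composition of two homotopic morphisms of $\mathbb E$-triangles.
   Context: Extriangulated categories (Nakaoka–Palu). Let $\mathcal C$ be an additive category and $\mathbb E:\mathcal C^{\mathrm{op}}\times\mathcal C\to\mathbf{Ab}$ an additive bifunctor. An element $\delta\in\mathbb E(Z,X)$ is an $\mathbb E$-extension; write $f_*=\mathbb E(-,f)$ and $g^*=\mathbb E(g,-)$. Two sequences $X\to Y\to Z$ and $X\to Y'\to Z$ are equivalent if there is an isomorphism $Y\cong Y'$ compatible with the maps from $X$ and to $Z$. An additive realization $\mathfrak s$ assigns to each $\delta\in\mathbb E(Z,X)$ an equivalence class $\mathfrak s(\delta)=[X\xrightarrow{f}Y\xrightarrow{g}Z]$ such that: (i) if $\delta\in\mathbb E(Z,X)$, $\delta'\in\mathbb E(Z',X')$, $\alpha:X\to X'$, $\gamma:Z\to Z'$ satisfy $\alpha_*\delta=\gamma^*\delta'$, then for any representatives $X\xrightarrow{f}Y\xrightarrow{g}Z$ of $\mathfrak s(\delta)$ and $X'\xrightarrow{f'}Y'\xrightarrow{g'}Z'$ of $\mathfrak s(\delta')$ there is $\beta:Y\to Y'$ with $\beta f=f'\alpha$, $g'\beta=\gamma g$; (ii) $0\in\mathbb E(Z,X)$ is realized by the split sequence $X\to X\oplus Z\to Z$; (iii) $\mathfrak s(\delta\oplus\delta')=\mathfrak s(\delta)\oplus\mathfrak s(\delta')$. If $\mathfrak s(\delta)=[X\xrightarrow{f}Y\xrightarrow{g}Z]$,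 one writes $X\xrightarrow{f}Y\xrightarrow{g}Z\overset{\delta}{\dashrightarrow}$ and calls it an $\mathbb E$-triangle, $f$ an $\mathbb E$-inflation, $g$ an $\mathbb E$-deflation. A morphism of $\mathbb E$-triangles from this one to $X'\xrightarrow{f'}Y'\xrightarrow{g'}Z'\overset{\delta'}{\dashrightarrow}$ is a triple $(\alpha,\beta,\gamma)$ with $\beta f=f'\alpha$, $g'\beta=\gamma g$, $\alpha_*\delta=\gamma^*\delta'$; composition is componentwise. $(\mathcal C,\mathbb E,\mathfrak s)$ is an extriangulated category if moreover: (ET3) for two such $\mathbb E$-triangles and $\alpha,\beta$ with $\beta f=f'\alpha$ there is $\gamma$ making $(\alpha,\beta,\gamma)$ a morphism of $\mathbb E$-triangles; (ET3$^{\mathrm{op}}$) given $\beta,\gamma$ with $\gamma g=g'\beta$ there is $\alpha$ making $(\alpha,\beta,\gamma)$ a morphism of $\mathbb E$-triangles; (ET4) given $\mathbb E$-triangles $A\xrightarrow{f}B\xrightarrow{g}D\overset{\delta}{\dashrightarrow}$ and $B\xrightarrow{u}C\xrightarrow{v}E\overset{\varepsilon}{\dashrightarrow}$ there are $\mathbb E$-triangles $A\xrightarrow{m}C\xrightarrow{h}F\overset{\theta}{\dashrightarrow}$ and $D\xrightarrow{w}F\xrightarrow{q}E\overset{\eta}{\dashrightarrow}$ with $m=uf$, $wg=hu$, $v=qh$, $w^*\theta=\delta$, $g_*\varepsilon=\eta$, $f_*\theta=q^*\varepsilon$; (ET4$^{\mathrm{op}}$) conversely, given the latter two $\mathbb E$-triangles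 there are $\mathbb E$-triangles of the former form satisfying the same six relations. Homotopic morphisms. A morphism $(\alpha,\beta,\gamma)$ of $\mathbb E$-triangles from $X\xrightarrow{f}Y\xrightarrow{g}Z\overset{\delta}{\dashrightarrow}$ to $X'\xrightarrow{f'}Y'\xrightarrow{g'}Z'\overset{\delta'}{\dashrightarrow}$ is homotopic if there are an $\mathbb E$-triangle $X'\xrightarrow{s}E\xrightarrow{t}Z\overset{\eta}{\dashrightarrow}$ and morphisms $\beta_1:Y\to E$, $\beta_2:E\to Y'$ with $\beta=\beta_2\beta_1$, such that $(\alpha,\beta_1,1_Z)$ (from the first $\mathbb E$-triangle to this one) and $(1_{X'},\beta_2,\gamma)$ (from this one to the second) are morphisms of $\mathbb E$-triangles, and $X\xrightarrow{\left(\begin{smallmatrix}f\\ \alpha\end{smallmatrix}\right)}Y\oplus X'\xrightarrow{(\beta_1,-s)}E\overset{t^*\delta}{\dashrightarrow}$ and $E\xrightarrow{\left(\begin{smallmatrix}-t\\ \beta_2\end{smallmatrix}\right)}Z\oplus Y'\xrightarrow{(\gamma,g')}Z'\overset{s_*\delta'}{\dashrightarrow}$ are $\mathbb E$-triangles. *)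

theory Defs
  imports "HOL-Algebra.Group"
begin

text \<open>
  The abelian groups of morphisms and of extensions are commutative groups in the sense of
  \<^theory>\<open>HOL-Algebra.Group\<close>, hence written multiplicatively: on a group of morphisms or
  extensions, the symbol \<open>\<otimes>\<close> is the sum, \<open>\<one>\<close> is zero and \<open>inv\<close> is the negative.  Composition of
  morphisms is \<open>g \<cdot> f\<close> (first \<open>f\<close>, then \<open>g\<close>).
\<close>

record ('o, 'm) cat =
  Obj :: "'o set"
  Hom :: "'o \<Rightarrow> 'o \<Rightarrow> 'm monoid"
  Comp :: "'m \<Rightarrow> 'm \<Rightarrow> 'm"  (infixr "\<cdot>\<index>" 75)
  Idm :: "'o \<Rightarrow> 'm"

abbreviation mor :: "('o, 'm, 'r) cat_scheme \<Rightarrow> 'o \<Rightarrow> 'o \<Rightarrow> 'm set" where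
  "mor C X Y \<equiv> carrier (Hom C X Y)"

record ('o, 'm) biprod =
  ob :: 'o
  in1 :: 'm
  in2 :: 'm
  pr1 :: 'm
  pr2 :: 'm

definition is_biproduct ::
  "('o, 'm, 'r) cat_scheme \<Rightarrow> 'o \<Rightarrow> 'o \<Rightarrow> ('o, 'm) biprod \<Rightarrow> bool" where
  "is_biproduct C A B S \<longleftrightarrow>
     ob S \<in> Obj C \<and>
     in1 S \<in> mor C A (ob S) \<and> in2 S \<in> mor C B (ob S) \<and>
     pr1 S \<in> mor C (ob S) A \<and> pr2 S \<in> mor C (ob S) B \<and>
     pr1 S \<cdot>\<^bsub>C\<^esub> in1 S = Idm C A \<and> pr2 S \<cdot>\<^bsub>C\<^esub> in2 S = Idm C B \<and>
     pr1 S \<cdot>\<^bsub>C\<^esub> in2 S = \<one>\<^bsub>Hom C B A\<^esub> \<and> pr2 S \<cdot>\<^bsub>C\<^esub> in1 S = \<one>\<^bsub>Hom C A B\<^esub> \<and>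
     in1 S \<cdot>\<^bsub>C\<^esub> pr1 S \<otimes>\<^bsub>Hom C (ob S) (ob S)\<^esub> in2 S \<cdot>\<^bsub>C\<^esub> pr2 S = Idm C (ob S)"

definition is_zero_object :: "('o, 'm, 'r) cat_scheme \<Rightarrow> 'o \<Rightarrow> bool" where
  "is_zero_object C N \<longleftrightarrow> N \<in> Obj C \<and>
     (\<forall>X\<in>Obj C. (\<exists>!f. f \<in> mor C X N) \<and> (\<exists>!f. f \<in> mor C N X))"

locale additive_category =
  fixes C :: "('o, 'm, 'r) cat_scheme" (structure)
  assumes hom_disjoint:
      "\<lbrakk>X \<in> Obj C; Y \<in> Obj C; X' \<in> Obj C; Y' \<in> Obj C; f \<in> mor C X Y; f \<in> mor C X' Y'\<rbrakk>
        \<Longrightarrow> X = X' \<and> Y = Y'"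
    and id_closed: "X \<in> Obj C \<Longrightarrow> Idm C X \<in> mor C X X"
    and comp_closed:
      "\<lbrakk>X \<in> Obj C; Y \<in> Obj C; Z \<in> Obj C; f \<in> mor C X Y; g \<in> mor C Y Z\<rbrakk> \<Longrightarrow> g \<cdot> f \<in> mor C X Z"
    and id_left: "\<lbrakk>X \<in> Obj C; Y \<in> Obj C; f \<in> mor C X Y\<rbrakk> \<Longrightarrow> Idm C Y \<cdot> f = f"
    and id_right: "\<lbrakk>X \<in> Obj C; Y \<in> Obj C; f \<in> mor C X Y\<rbrakk> \<Longrightarrow> f \<cdot> Idm C X = f"
    and comp_assoc:
      "\<lbrakk>W \<in> Obj C; X \<in> Obj C; Y \<in> Obj C; Z \<in> Obj C; f \<in> mor C W X; g \<in> mor C X Y; h \<in> mor C Y Z\<rbrakk>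
        \<Longrightarrow> (h \<cdot> g) \<cdot> f = h \<cdot> (g \<cdot> f)"
    and hom_group: "\<lbrakk>X \<in> Obj C; Y \<in> Obj C\<rbrakk> \<Longrightarrow> comm_group (Hom C X Y)"
    and comp_additive_left:
      "\<lbrakk>X \<in> Obj C; Y \<in> Obj C; Z \<in> Obj C; f \<in> mor C X Y\<rbrakk> \<Longrightarrow> (\<lambda>g. g \<cdot> f) \<in> hom (Hom C Y Z) (Hom C X Z)"
    and comp_additive_right:
      "\<lbrakk>X \<in> Obj C; Y \<in> Obj C; Z \<in> Obj C; g \<in> mor C Y Z\<rbrakk> \<Longrightarrow> (\<lambda>f. g \<cdot> f) \<in> hom (Hom C X Y) (Hom C X Z)"
    and zero_object: "\<exists>N. is_zero_object C N"
    and biproducts: "\<lbrakk>A \<in> Obj C; B \<in> Obj C\<rbrakk> \<Longrightarrow> \<exists>S. is_biproduct C A B S"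

text \<open>
  A fixed choice of the direct sum of two objects.  Nothing below depends on the choice, since direct
  sums are unique up to a unique isomorphism compatible with injections and projections, and
  realizations are isomorphism classes of sequences.
\<close>

definition bip :: "('o, 'm, 'r) cat_scheme \<Rightarrow> 'o \<Rightarrow> 'o \<Rightarrow> ('o, 'm) biprod" where
  "bip C A B = (SOME S. is_biproduct C A B S)"

abbreviation dsum :: "('o, 'm, 'r) cat_scheme \<Rightarrow> 'o \<Rightarrow> 'o \<Rightarrow> 'o" where
  "dsum C A B \<equiv> ob (bip C A B)"

lemma (in additive_category) bip_is_biproduct:
  "\<lbrakk>A \<in> Obj C; B \<in> Obj C\<rbrakk> \<Longrightarrow> is_biproduct C A B (bip C A B)"
  unfolding bip_def using biproducts by (rule someI_ex)

text \<open>The column from \<open>X\<close> to \<open>A \<oplus> B\<close> with entries \<open>f\<close> and \<open>g\<close>.\<close>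

definition col :: "('o, 'm, 'r) cat_scheme \<Rightarrow> 'o \<Rightarrow> 'o \<Rightarrow> 'o \<Rightarrow> 'm \<Rightarrow> 'm \<Rightarrow> 'm" where
  "col C X A B f g =
     in1 (bip C A B) \<cdot>\<^bsub>C\<^esub> f \<otimes>\<^bsub>Hom C X (dsum C A B)\<^esub> in2 (bip C A B) \<cdot>\<^bsub>C\<^esub> g"

text \<open>The row from \<open>A \<oplus> B\<close> to \<open>Y\<close> with entries \<open>f\<close> and \<open>g\<close>.\<close>

definition row :: "('o, 'm, 'r) cat_scheme \<Rightarrow> 'o \<Rightarrow> 'o \<Rightarrow> 'o \<Rightarrow> 'm \<Rightarrow> 'm \<Rightarrow> 'm" where
  "row C A B Y f g =
     f \<cdot>\<^bsub>C\<^esub> pr1 (bip C A B) \<otimes>\<^bsub>Hom C (dsum C A B) Y\<^esub> g \<cdot>\<^bsub>C\<^esub> pr2 (bip C A B)"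

text \<open>The diagonal morphism \<open>f \<oplus> g\<close> from \<open>A \<oplus> B\<close> to \<open>A' \<oplus> B'\<close>.\<close>

definition diag_mor ::
  "('o, 'm, 'r) cat_scheme \<Rightarrow> 'o \<Rightarrow> 'o \<Rightarrow> 'o \<Rightarrow> 'o \<Rightarrow> 'm \<Rightarrow> 'm \<Rightarrow> 'm" where
  "diag_mor C A B A' B' f g =
     in1 (bip C A' B') \<cdot>\<^bsub>C\<^esub> f \<cdot>\<^bsub>C\<^esub> pr1 (bip C A B)
       \<otimes>\<^bsub>Hom C (dsum C A B) (dsum C A' B')\<^esub>
     in2 (bip C A' B') \<cdot>\<^bsub>C\<^esub> g \<cdot>\<^bsub>C\<^esub> pr2 (bip C A B)"

text \<open>The sequence \<open>X \<rightarrow> Y \<rightarrow> Z\<close> with morphisms \<open>f\<close> and \<open>g\<close> is the triple \<open>(f, Y, g)\<close>.\<close>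

type_synonym ('o, 'm) sequence = "'m \<times> 'o \<times> 'm"

definition sequences :: "('o, 'm, 'r) cat_scheme \<Rightarrow> 'o \<Rightarrow> 'o \<Rightarrow> ('o, 'm) sequence set" where
  "sequences C X Z = {(f, Y, g). Y \<in> Obj C \<and> f \<in> mor C X Y \<and> g \<in> mor C Y Z}"

definition iso_mor :: "('o, 'm, 'r) cat_scheme \<Rightarrow> 'o \<Rightarrow> 'o \<Rightarrow> 'm \<Rightarrow> bool" where
  "iso_mor C Y Y' b \<longleftrightarrow> b \<in> mor C Y Y' \<and>
     (\<exists>c\<in>mor C Y' Y. c \<cdot>\<^bsub>C\<^esub> b = Idm C Y \<and> b \<cdot>\<^bsub>C\<^esub> c = Idm C Y')"

definition seq_equiv ::
  "('o, 'm, 'r) cat_scheme \<Rightarrow> 'o \<Rightarrow> 'o \<Rightarrow> (('o, 'm) sequence \<times> ('o, 'm) sequence) set" where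
  "seq_equiv C X Z = {((f, Y, g), (f', Y', g')).
     (f, Y, g) \<in> sequences C X Z \<and> (f', Y', g') \<in> sequences C X Z \<and>
     (\<exists>b. iso_mor C Y Y' b \<and> b \<cdot>\<^bsub>C\<^esub> f = f' \<and> g' \<cdot>\<^bsub>C\<^esub> b = g)}"

text \<open>
  \<open>Ext C Z X\<close> is the group of extensions of \<open>Z\<close> by \<open>X\<close>.  For \<open>g\<close> from \<open>Z'\<close> to \<open>Z\<close> and \<open>f\<close> from \<open>X\<close> to
  \<open>X'\<close>, the bifunctor acts by \<open>Emap C g f\<close> from \<open>Ext C Z X\<close> to \<open>Ext C Z' X'\<close>; as morphisms determine
  their domain and codomain, no objects need to be passed.  \<open>Real C Z X \<delta>\<close> is the class of
  sequences that realizes \<open>\<delta> \<in> Ext C Z X\<close>.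
\<close>

record ('o, 'm, 'e) extri = "('o, 'm) cat" +
  Ext :: "'o \<Rightarrow> 'o \<Rightarrow> 'e monoid"
  Emap :: "'m \<Rightarrow> 'm \<Rightarrow> 'e \<Rightarrow> 'e"
  Real :: "'o \<Rightarrow> 'o \<Rightarrow> 'e \<Rightarrow> ('o, 'm) sequence set"

abbreviation ext :: "('o, 'm, 'e, 'r) extri_scheme \<Rightarrow> 'o \<Rightarrow> 'o \<Rightarrow> 'e set" where
  "ext C Z X \<equiv> carrier (Ext C Z X)"

text \<open>\<open>push C Z f \<delta>\<close> is \<open>f\<^sub>* \<delta>\<close> for \<open>\<delta> \<in> Ext C Z X\<close>, and \<open>pull C X g \<delta>\<close> is \<open>g\<^sup>* \<delta>\<close>.\<close>

definition push :: "('o, 'm, 'e, 'r) extri_scheme \<Rightarrow> 'o \<Rightarrow> 'm \<Rightarrow> 'e \<Rightarrow> 'e" where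
  "push C Z f = Emap C (Idm C Z) f"

definition pull :: "('o, 'm, 'e, 'r) extri_scheme \<Rightarrow> 'o \<Rightarrow> 'm \<Rightarrow> 'e \<Rightarrow> 'e" where
  "pull C X g = Emap C g (Idm C X)"

text \<open>
  The extension \<open>\<delta> \<oplus> \<delta>'\<close> of \<open>Z \<oplus> Z'\<close> by \<open>X \<oplus> X'\<close>: the element with components \<open>\<delta>, 0, 0, \<delta>'\<close> under
  \<open>\<bbbE>(Z \<oplus> Z', X \<oplus> X') \<cong> \<bbbE>(Z, X) \<oplus> \<bbbE>(Z, X') \<oplus> \<bbbE>(Z', X) \<oplus> \<bbbE>(Z', X')\<close>,
  obtained by applying the inverse of this isomorphism.
\<close>

definition ext_sum ::
  "('o, 'm, 'e, 'r) extri_scheme \<Rightarrow> 'o \<Rightarrow> 'o \<Rightarrow> 'e \<Rightarrow> 'o \<Rightarrow> 'o \<Rightarrow> 'e \<Rightarrow> 'e" where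
  "ext_sum C Z X d Z' X' d' =
     Emap C (pr1 (bip C Z Z')) (in1 (bip C X X')) d
       \<otimes>\<^bsub>Ext C (dsum C Z Z') (dsum C X X')\<^esub>
     Emap C (pr2 (bip C Z Z')) (in2 (bip C X X')) d'"

locale additive_bifunctor = additive_category C
  for C :: "('o, 'm, 'e, 'r) extri_scheme" (structure) +
  assumes ext_group: "\<lbrakk>Z \<in> Obj C; X \<in> Obj C\<rbrakk> \<Longrightarrow> comm_group (Ext C Z X)"
    and emap_hom:
      "\<lbrakk>Z \<in> Obj C; Z' \<in> Obj C; X \<in> Obj C; X' \<in> Obj C; g \<in> mor C Z' Z; f \<in> mor C X X'\<rbrakk>
        \<Longrightarrow> Emap C g f \<in> hom (Ext C Z X) (Ext C Z' X')"
    and emap_id: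
      "\<lbrakk>Z \<in> Obj C; X \<in> Obj C; d \<in> ext C Z X\<rbrakk> \<Longrightarrow> Emap C (Idm C Z) (Idm C X) d = d"
    and emap_comp:
      "\<lbrakk>Z \<in> Obj C; Z' \<in> Obj C; Z'' \<in> Obj C; X \<in> Obj C; X' \<in> Obj C; X'' \<in> Obj C;
        g \<in> mor C Z' Z; g' \<in> mor C Z'' Z'; f \<in> mor C X X'; f' \<in> mor C X' X''; d \<in> ext C Z X\<rbrakk>
        \<Longrightarrow> Emap C (g \<cdot> g') (f' \<cdot> f) d = Emap C g' f' (Emap C g f d)"
    and push_additive:
      "\<lbrakk>Z \<in> Obj C; X \<in> Obj C; X' \<in> Obj C; d \<in> ext C Z X\<rbrakk>
        \<Longrightarrow> (\<lambda>f. push C Z f d) \<in> hom (Hom C X X') (Ext C Z X')"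
    and pull_additive:
      "\<lbrakk>Z \<in> Obj C; Z' \<in> Obj C; X \<in> Obj C; d \<in> ext C Z X\<rbrakk>
        \<Longrightarrow> (\<lambda>g. pull C X g d) \<in> hom (Hom C Z' Z) (Ext C Z' X)"

locale additive_realization = additive_bifunctor C
  for C :: "('o, 'm, 'e, 'r) extri_scheme" (structure) +
  assumes real_class:
      "\<lbrakk>Z \<in> Obj C; X \<in> Obj C; d \<in> ext C Z X\<rbrakk>
        \<Longrightarrow> Real C Z X d \<in> sequences C X Z // seq_equiv C X Z"
    and real_morphism:
      "\<lbrakk>Z \<in> Obj C; X \<in> Obj C; Z' \<in> Obj C; X' \<in> Obj C; d \<in> ext C Z X; d' \<in> ext C Z' X';
        a \<in> mor C X X'; c \<in> mor C Z Z'; push C Z a d = pull C X' c d';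
        (f, Y, g) \<in> Real C Z X d; (f', Y', g') \<in> Real C Z' X' d'\<rbrakk>
        \<Longrightarrow> \<exists>b\<in>mor C Y Y'. b \<cdot> f = f' \<cdot> a \<and> g' \<cdot> b = c \<cdot> g"
    and real_zero:
      "\<lbrakk>Z \<in> Obj C; X \<in> Obj C\<rbrakk>
        \<Longrightarrow> (in1 (bip C X Z), dsum C X Z, pr2 (bip C X Z)) \<in> Real C Z X \<one>\<^bsub>Ext C Z X\<^esub>"
    and real_sum:
      "\<lbrakk>Z \<in> Obj C; X \<in> Obj C; Z' \<in> Obj C; X' \<in> Obj C; d \<in> ext C Z X; d' \<in> ext C Z' X';
        (f, Y, g) \<in> Real C Z X d; (f', Y', g') \<in> Real C Z' X' d'\<rbrakk>
        \<Longrightarrow> (diag_mor C X X' Y Y' f f', dsum C Y Y', diag_mor C Y Y' Z Z' g g')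
             \<in> Real C (dsum C Z Z') (dsum C X X') (ext_sum C Z X d Z' X' d')"

text \<open>The tuple \<open>(X, f, Y, g, Z, \<delta>)\<close> stands for \<open>X \<rightarrow> Y \<rightarrow> Z\<close> with extension \<open>\<delta> \<in> Ext C Z X\<close>.\<close>

type_synonym ('o, 'm, 'e) tri = "'o \<times> 'm \<times> 'o \<times> 'm \<times> 'o \<times> 'e"

fun E_triangle :: "('o, 'm, 'e, 'r) extri_scheme \<Rightarrow> ('o, 'm, 'e) tri \<Rightarrow> bool" where
  "E_triangle C (X, f, Y, g, Z, d) \<longleftrightarrow>
     X \<in> Obj C \<and> Z \<in> Obj C \<and> d \<in> ext C Z X \<and> (f, Y, g) \<in> Real C Z X d"

fun E_morphism ::
  "('o, 'm, 'e, 'r) extri_scheme \<Rightarrow> ('o, 'm, 'e) tri \<Rightarrow> ('o, 'm, 'e) tri \<Rightarrow> 'm \<times> 'm \<times> 'm \<Rightarrow> bool"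
where
  "E_morphism C (X, f, Y, g, Z, d) (X', f', Y', g', Z', d') (a, b, c) \<longleftrightarrow>
     E_triangle C (X, f, Y, g, Z, d) \<and> E_triangle C (X', f', Y', g', Z', d') \<and>
     a \<in> mor C X X' \<and> b \<in> mor C Y Y' \<and> c \<in> mor C Z Z' \<and>
     b \<cdot>\<^bsub>C\<^esub> f = f' \<cdot>\<^bsub>C\<^esub> a \<and> g' \<cdot>\<^bsub>C\<^esub> b = c \<cdot>\<^bsub>C\<^esub> g \<and>
     push C Z a d = pull C X' c d'"

fun E_comp ::
  "('o, 'm, 'e, 'r) extri_scheme \<Rightarrow> 'm \<times> 'm \<times> 'm \<Rightarrow> 'm \<times> 'm \<times> 'm \<Rightarrow> 'm \<times> 'm \<times> 'm" where
  "E_comp C (a', b', c') (a, b, c) = (a' \<cdot>\<^bsub>C\<^esub> a, b' \<cdot>\<^bsub>C\<^esub> b, c' \<cdot>\<^bsub>C\<^esub> c)"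

locale extriangulated_category = additive_realization C
  for C :: "('o, 'm, 'e, 'r) extri_scheme" (structure) +
  assumes ET3:
      "\<lbrakk>E_triangle C (X, f, Y, g, Z, d); E_triangle C (X', f', Y', g', Z', d');
        a \<in> mor C X X'; b \<in> mor C Y Y'; b \<cdot> f = f' \<cdot> a\<rbrakk>
        \<Longrightarrow> \<exists>c. E_morphism C (X, f, Y, g, Z, d) (X', f', Y', g', Z', d') (a, b, c)"
    and ET3_op:
      "\<lbrakk>E_triangle C (X, f, Y, g, Z, d); E_triangle C (X', f', Y', g', Z', d');
        b \<in> mor C Y Y'; c \<in> mor C Z Z'; c \<cdot> g = g' \<cdot> b\<rbrakk>
        \<Longrightarrow> \<exists>a. E_morphism C (X, f, Y, g, Z, d) (X', f', Y', g', Z', d') (a, b, c)"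
    and ET4:
      "\<lbrakk>E_triangle C (A, f, B, g, D, \<delta>); E_triangle C (B, u, M, v, E, \<epsilon>)\<rbrakk>
        \<Longrightarrow> \<exists>m h F \<theta> w q \<eta>.
              E_triangle C (A, m, M, h, F, \<theta>) \<and> E_triangle C (D, w, F, q, E, \<eta>) \<and>
              m = u \<cdot> f \<and> w \<cdot> g = h \<cdot> u \<and> v = q \<cdot> h \<and>
              pull C A w \<theta> = \<delta> \<and> push C E g \<epsilon> = \<eta> \<and> push C F f \<theta> = pull C B q \<epsilon>"
    and ET4_op:
      "\<lbrakk>E_triangle C (A, m, M, h, F, \<theta>); E_triangle C (D, w, F, q, E, \<eta>)\<rbrakk>
        \<Longrightarrow> \<exists>f B g \<delta> u v \<epsilon>.
              E_triangle C (A, f, B, g, D, \<delta>) \<and> E_triangle C (B, u, M, v, E, \<epsilon>) \<and>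
              m = u \<cdot> f \<and> w \<cdot> g = h \<cdot> u \<and> v = q \<cdot> h \<and>
              pull C A w \<theta> = \<delta> \<and> push C E g \<epsilon> = \<eta> \<and> push C F f \<theta> = pull C B q \<epsilon>"

fun homotopic ::
  "('o, 'm, 'e, 'r) extri_scheme \<Rightarrow> ('o, 'm, 'e) tri \<Rightarrow> ('o, 'm, 'e) tri \<Rightarrow> 'm \<times> 'm \<times> 'm \<Rightarrow> bool"
where
  "homotopic C (X, f, Y, g, Z, \<delta>) (X', f', Y', g', Z', \<delta>') (\<alpha>, \<beta>, \<gamma>) \<longleftrightarrow>
     E_morphism C (X, f, Y, g, Z, \<delta>) (X', f', Y', g', Z', \<delta>') (\<alpha>, \<beta>, \<gamma>) \<and>
     (\<exists>s E t \<eta> \<beta>\<^sub>1 \<beta>\<^sub>2.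
        E_triangle C (X', s, E, t, Z, \<eta>) \<and>
        \<beta>\<^sub>1 \<in> mor C Y E \<and> \<beta>\<^sub>2 \<in> mor C E Y' \<and> \<beta> = \<beta>\<^sub>2 \<cdot>\<^bsub>C\<^esub> \<beta>\<^sub>1 \<and>
        E_morphism C (X, f, Y, g, Z, \<delta>) (X', s, E, t, Z, \<eta>) (\<alpha>, \<beta>\<^sub>1, Idm C Z) \<and>
        E_morphism C (X', s, E, t, Z, \<eta>) (X', f', Y', g', Z', \<delta>') (Idm C X', \<beta>\<^sub>2, \<gamma>) \<and>
        E_triangle C (X, col C X Y X' f \<alpha>, dsum C Y X',
          row C Y X' E \<beta>\<^sub>1 (inv\<^bsub>Hom C X' E\<^esub> s), E, pull C X t \<delta>) \<and>
        E_triangle C (E, col C E Z Y' (inv\<^bsub>Hom C E Z\<^esub> t) \<beta>\<^sub>2, dsum C Z Y',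
          row C Z Y' Z' \<gamma> g', Z', push C Z' s \<delta>'))"

end

theory Submission
  imports Defs
begin

text \<open>
  The intermediate triangle is the direct sum \<open>T \<oplus> T'\<close> of the source and the target of the given
  morphism \<open>\<phi> = (\<alpha>, \<beta>, \<gamma>)\<close>.  In matrix notation

    \<open>\<phi> = (0, 1) \<cdot> A \<cdot> (1, 0)\<^sup>T\<close>  with  \<open>A = 1 + in\<^sub>2 \<cdot> \<phi> \<cdot> pr\<^sub>1\<close>,

  where \<open>(1, 0)\<^sup>T\<close> is the inclusion of \<open>T\<close> into \<open>T \<oplus> T'\<close>, \<open>(0, 1)\<close> is the projection onto \<open>T'\<close>, and
  the shear \<open>A\<close> is an automorphism of \<open>T \<oplus> T'\<close>, with inverse \<open>1 - in\<^sub>2 \<cdot> \<phi> \<cdot> pr\<^sub>1\<close>.  A homotopic morphism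
  followed by an isomorphism of triangles is again homotopic (\<open>homotopic_iso\<close>), so it remains to see
  that the inclusion and the projection are homotopic (\<open>inclusion_homotopic\<close>,
  \<open>projection_homotopic\<close>); then \<open>A \<cdot> (1, 0)\<^sup>T\<close> and \<open>(0, 1)\<close> are the two factors.

  The inclusion is the direct sum of the identity of \<open>T\<close> and the morphism from zero to \<open>T'\<close>, and the
  projection is the direct sum of the morphism from \<open>T\<close> to zero and the identity of \<open>T'\<close>.  For
  these the triangles that witness a homotopic morphism can be written down: up to isomorphism each
  of them is split, or a direct sum of \<open>T\<close> or \<open>T'\<close> with a split triangle.  That the extensions agree
  comes down to \<open>g\<^sup>*\<delta> = 0\<close> and \<open>f\<^sub>*\<delta> = 0\<close> in a triangle with maps \<open>f\<close>, \<open>g\<close> and extension \<open>\<delta>\<close>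
  (\<open>emap_deflation\<close>, \<open>emap_inflation\<close>).  The tool that turns such a description into a triangle is
  \<open>triangle_iso\<close>: a sequence isomorphic to a triangle, compatibly with the extensions, is a triangle.
  It rests on the fact that an endomorphism of the middle term that fixes both maps of a triangle is
  unipotent.
\<close>

section \<open>Arithmetic of morphisms\<close>

text \<open>
  A morphism determines its source and its target.  Hence the sum and the negative can be written
  without the group they are formed in, and all side conditions of the laws of an additive category
  become equations between sources and targets, which conditional rewriting can discharge.
\<close>

context additive_category
begin

definition arr :: "'m \<Rightarrow> bool" where
  "arr f \<longleftrightarrow> (\<exists>X\<in>Obj C. \<exists>Y\<in>Obj C. f \<in> mor C X Y)"

definition src :: "'m \<Rightarrow> 'o" where
  "src f = (THE X. X \<in> Obj C \<and> (\<exists>Y\<in>Obj C. f \<in> mor C X Y))"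

definition tgt :: "'m \<Rightarrow> 'o" where
  "tgt f = (THE Y. Y \<in> Obj C \<and> (\<exists>X\<in>Obj C. f \<in> mor C X Y))"

definition add :: "'m \<Rightarrow> 'm \<Rightarrow> 'm"  (infixl "\<boxplus>" 65) where
  "f \<boxplus> g = f \<otimes>\<^bsub>Hom C (src f) (tgt f)\<^esub> g"

definition neg :: "'m \<Rightarrow> 'm"  ("\<boxminus> _" [80] 80) where
  "\<boxminus> f = inv\<^bsub>Hom C (src f) (tgt f)\<^esub> f"

abbreviation zero :: "'o \<Rightarrow> 'o \<Rightarrow> 'm" where
  "zero X Y \<equiv> \<one>\<^bsub>Hom C X Y\<^esub>"

lemma mor_iff:
  assumes "X \<in> Obj C" "Y \<in> Obj C"
  shows "f \<in> mor C X Y \<longleftrightarrow> arr f \<and> src f = X \<and> tgt f = Y"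
proof -
  have "src f = X \<and> tgt f = Y" if "X \<in> Obj C" "Y \<in> Obj C" "f \<in> mor C X Y" for X Y
    unfolding src_def tgt_def using that hom_disjoint[OF _ _ that(1,2) _ that(3)]
    by (intro conjI the_equality) blast+
  then show ?thesis
    using assms unfolding arr_def by blast
qed

lemma arr_objects [simp]:
  assumes "arr f"
  shows "src f \<in> Obj C" "tgt f \<in> Obj C"
  using assms mor_iff unfolding arr_def by metis+

lemma arr_mor: "arr f \<Longrightarrow> f \<in> mor C (src f) (tgt f)"
  by (simp add: mor_iff)

lemma arr_id [simp]:
  assumes "X \<in> Obj C"
  shows "arr (Idm C X)" "src (Idm C X) = X" "tgt (Idm C X) = X"
  using id_closed[OF assms] assms by (auto simp: mor_iff)

lemma arr_comp [simp]:
  assumes "arr f" "arr g" "src g = tgt f"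
  shows "arr (g \<cdot> f)" "src (g \<cdot> f) = src f" "tgt (g \<cdot> f) = tgt g"
proof -
  have "g \<cdot> f \<in> mor C (src f) (tgt g)"
    using assms by (intro comp_closed[of _ "tgt f"]) (auto simp: mor_iff)
  then show "arr (g \<cdot> f)" "src (g \<cdot> f) = src f" "tgt (g \<cdot> f) = tgt g"
    using assms by (auto simp: mor_iff)
qed

lemma arr_zero [simp]:
  assumes "X \<in> Obj C" "Y \<in> Obj C"
  shows "arr (zero X Y)" "src (zero X Y) = X" "tgt (zero X Y) = Y"
proof -
  interpret comm_group "Hom C X Y" using hom_group assms by blast
  show "arr (zero X Y)" "src (zero X Y) = X" "tgt (zero X Y) = Y"
    using one_closed mor_iff[OF assms] by blast+
qed

lemma comp_id [simp]:
  assumes "arr f"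
  shows "tgt f = Y \<Longrightarrow> Idm C Y \<cdot> f = f" "src f = X \<Longrightarrow> f \<cdot> Idm C X = f"
  using assms id_left[OF _ _ arr_mor] id_right[OF _ _ arr_mor] by auto

lemma assoc [simp]:
  "\<lbrakk>arr f; arr g; arr h; src g = tgt f; src h = tgt g\<rbrakk> \<Longrightarrow> (h \<cdot> g) \<cdot> f = h \<cdot> (g \<cdot> f)"
  by (rule comp_assoc[of "src f" "tgt f" "tgt g" "tgt h"]) (auto simp: mor_iff)

lemma comp_eq_comp:
  "\<lbrakk>h \<cdot> g = k; arr f; arr g; arr h; src g = tgt f; src h = tgt g\<rbrakk> \<Longrightarrow> h \<cdot> (g \<cdot> f) = k \<cdot> f"
  using assoc[of f g h] by simp

lemma arr_add [simp]:
  assumes "arr f" "arr g" "src f = src g" "tgt f = tgt g"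
  shows "arr (f \<boxplus> g)" "src (f \<boxplus> g) = src g" "tgt (f \<boxplus> g) = tgt g"
proof -
  interpret comm_group "Hom C (src g) (tgt g)" using hom_group assms by simp
  have "f \<boxplus> g \<in> mor C (src g) (tgt g)"
    unfolding add_def using assms arr_mor by (metis m_closed)
  then show "arr (f \<boxplus> g)" "src (f \<boxplus> g) = src g" "tgt (f \<boxplus> g) = tgt g"
    using assms by (auto simp: mor_iff)
qed

lemma arr_neg [simp]:
  assumes "arr f"
  shows "arr (\<boxminus> f)" "src (\<boxminus> f) = src f" "tgt (\<boxminus> f) = tgt f"
proof -
  interpret comm_group "Hom C (src f) (tgt f)" using hom_group assms by simp
  have "\<boxminus> f \<in> mor C (src f) (tgt f)"
    unfolding neg_def using assms arr_mor by (metis inv_closed)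
  then show "arr (\<boxminus> f)" "src (\<boxminus> f) = src f" "tgt (\<boxminus> f) = tgt f"
    using assms by (auto simp: mor_iff)
qed

lemma add_fold: "\<lbrakk>src f = X; tgt f = Y\<rbrakk> \<Longrightarrow> f \<otimes>\<^bsub>Hom C X Y\<^esub> g = f \<boxplus> g"
  by (simp add: add_def)

lemma neg_fold [simp]: "\<lbrakk>src f = X; tgt f = Y\<rbrakk> \<Longrightarrow> inv\<^bsub>Hom C X Y\<^esub> f = \<boxminus> f"
  by (simp add: neg_def)

lemma add_group:
  assumes "arr f"
  shows add_zero [simp]: "\<lbrakk>src f = X; tgt f = Y\<rbrakk> \<Longrightarrow> f \<boxplus> zero X Y = f"
    and zero_add [simp]: "\<lbrakk>src f = X; tgt f = Y\<rbrakk> \<Longrightarrow> zero X Y \<boxplus> f = f"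
    and add_neg [simp]: "f \<boxplus> \<boxminus> f = zero (src f) (tgt f)"
    and neg_add [simp]: "\<boxminus> f \<boxplus> f = zero (src f) (tgt f)"
    and neg_neg [simp]: "\<boxminus> \<boxminus> f = f"
    and add_comm: "\<lbrakk>arr g; src g = src f; tgt g = tgt f\<rbrakk> \<Longrightarrow> f \<boxplus> g = g \<boxplus> f"
proof -
  interpret comm_group "Hom C (src f) (tgt f)" using hom_group assms by simp
  have f: "f \<in> mor C (src f) (tgt f)" using assms by (rule arr_mor)
  show "\<lbrakk>src f = X; tgt f = Y\<rbrakk> \<Longrightarrow> f \<boxplus> zero X Y = f"
    using f by (auto simp: add_def)
  show "\<lbrakk>src f = X; tgt f = Y\<rbrakk> \<Longrightarrow> zero X Y \<boxplus> f = f"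
    using f assms by (auto simp: add_def)
  show "f \<boxplus> \<boxminus> f = zero (src f) (tgt f)" "\<boxminus> f \<boxplus> f = zero (src f) (tgt f)"
    using f assms by (simp_all only: add_def neg_def[symmetric] arr_neg) (simp_all only: neg_def r_inv l_inv)
  have "\<boxminus> \<boxminus> f = inv\<^bsub>Hom C (src f) (tgt f)\<^esub> (\<boxminus> f)"
    using assms by (simp only: neg_def[of "\<boxminus> f"] arr_neg)
  then show "\<boxminus> \<boxminus> f = f"
    using f by (simp only: neg_def[of f] inv_inv)
  show "f \<boxplus> g = g \<boxplus> f" if "arr g" "src g = src f" "tgt g = tgt f"
    using f that arr_mor[of g] by (simp add: add_def m_comm)
qed

lemma add_assoc:
  assumes "arr f" "arr g" "arr h" "src f = src g" "src h = src g" "tgt f = tgt g" "tgt h = tgt g"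
  shows "(f \<boxplus> g) \<boxplus> h = f \<boxplus> (g \<boxplus> h)"
proof -
  interpret comm_group "Hom C (src g) (tgt g)" using hom_group assms by simp
  show ?thesis
    using m_assoc[of f g h] assms by (simp add: add_fold mor_iff)
qed

lemma add_left_comm:
  assumes "arr f" "arr g" "arr h" "src f = src g" "src h = src g" "tgt f = tgt g" "tgt h = tgt g"
  shows "f \<boxplus> (g \<boxplus> h) = g \<boxplus> (f \<boxplus> h)"
  using assms add_assoc[of f g h] add_assoc[of g f h] add_comm[of f g] by simp

lemmas add_ac = add_assoc add_comm add_left_comm

lemma add_neg_cancel [simp]:
  assumes "arr f" "arr g" "src f = src g" "tgt f = tgt g"
  shows "f \<boxplus> (\<boxminus> f \<boxplus> g) = g" "\<boxminus> f \<boxplus> (f \<boxplus> g) = g"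
  using assms by (simp_all add: add_assoc[symmetric])

lemma comp_add [simp]:
  assumes "arr f" "arr g" "arr h" "src f = src g" "tgt f = tgt g" "src h = tgt g"
  shows "h \<cdot> (f \<boxplus> g) = h \<cdot> f \<boxplus> h \<cdot> g"
  using comp_additive_right[of "src g" "tgt g" "tgt h" h] assms
  by (simp add: mor_iff hom_def add_fold)

lemma add_comp [simp]:
  assumes "arr f" "arr g" "arr h" "src f = src g" "tgt f = tgt g" "tgt h = src g"
  shows "(f \<boxplus> g) \<cdot> h = f \<cdot> h \<boxplus> g \<cdot> h"
  using comp_additive_left[of "src h" "tgt h" "tgt g" h] assms
  by (simp add: mor_iff hom_def add_fold)

lemma comp_zero [simp]:
  assumes "arr h" "src h = Y" "X \<in> Obj C"
  shows "h \<cdot> zero X Y = zero X (tgt h)"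
proof -
  have "group_hom (Hom C X Y) (Hom C X (tgt h)) (\<lambda>f. h \<cdot> f)"
    using assms comp_additive_right[of X Y "tgt h" h] hom_group[of X Y] hom_group[of X "tgt h"]
    by (auto simp: group_hom_def group_hom_axioms_def comm_group_def mor_iff)
  then show ?thesis by (rule group_hom.hom_one)
qed

lemma zero_comp [simp]:
  assumes "arr h" "tgt h = X" "Y \<in> Obj C"
  shows "zero X Y \<cdot> h = zero (src h) Y"
proof -
  have "group_hom (Hom C X Y) (Hom C (src h) Y) (\<lambda>f. f \<cdot> h)"
    using assms comp_additive_left[of "src h" X Y h] hom_group[of X Y] hom_group[of "src h" Y]
    by (auto simp: group_hom_def group_hom_axioms_def comm_group_def mor_iff)
  then show ?thesis by (rule group_hom.hom_one)
qed

lemma neg_unique: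
  assumes "arr f" "arr g" "src f = src g" "tgt f = tgt g" "f \<boxplus> g = zero (src g) (tgt g)"
  shows "\<boxminus> f = g"
  using assms add_neg_cancel(2)[of f g] by simp

lemma comp_neg [simp]:
  assumes "arr f" "arr h" "src h = tgt f"
  shows "h \<cdot> \<boxminus> f = \<boxminus> (h \<cdot> f)"
  using assms by (intro neg_unique[symmetric]) (simp_all flip: comp_add)

lemma neg_comp [simp]:
  assumes "arr f" "arr h" "src f = tgt h"
  shows "\<boxminus> f \<cdot> h = \<boxminus> (f \<cdot> h)"
  using assms by (intro neg_unique[symmetric]) (simp_all flip: add_comp)

lemma neg_zero [simp]: "\<lbrakk>X \<in> Obj C; Y \<in> Obj C\<rbrakk> \<Longrightarrow> \<boxminus> (zero X Y) = zero X Y"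
  by (rule neg_unique) simp_all

definition inverses :: "'m \<Rightarrow> 'm \<Rightarrow> bool" where
  "inverses a a' \<longleftrightarrow> arr a \<and> arr a' \<and> src a' = tgt a \<and> tgt a' = src a \<and>
     a' \<cdot> a = Idm C (src a) \<and> a \<cdot> a' = Idm C (tgt a)"

lemma inverses_arr:
  assumes "inverses a a'"
  shows "arr a" "arr a'" "src a' = tgt a" "tgt a' = src a"
    "a' \<cdot> a = Idm C (src a)" "a \<cdot> a' = Idm C (tgt a)"
  using assms unfolding inverses_def by simp_all

lemma inverses_cancel:
  assumes "inverses a a'" "arr h"
  shows "tgt h = src a \<Longrightarrow> a' \<cdot> (a \<cdot> h) = h" "tgt h = tgt a \<Longrightarrow> a \<cdot> (a' \<cdot> h) = h"
proof -
  note a = inverses_arr[OF assms(1)]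
  have "a' \<cdot> (a \<cdot> h) = (a' \<cdot> a) \<cdot> h" if "tgt h = src a"
    using a assms(2) that by (intro assoc[symmetric]) auto
  then show "tgt h = src a \<Longrightarrow> a' \<cdot> (a \<cdot> h) = h"
    using a assms(2) by simp
  have "a \<cdot> (a' \<cdot> h) = (a \<cdot> a') \<cdot> h" if "tgt h = tgt a"
    using a assms(2) that by (intro assoc[symmetric]) auto
  then show "tgt h = tgt a \<Longrightarrow> a \<cdot> (a' \<cdot> h) = h"
    using a assms(2) by simp
qed

lemma inverses_sym: "inverses a a' \<Longrightarrow> inverses a' a"
  by (simp add: inverses_def)

lemma inverses_id [simp]: "X \<in> Obj C \<Longrightarrow> inverses (Idm C X) (Idm C X)"
  by (simp add: inverses_def)

lemma inverses_comp:
  assumes "inverses a a'" "inverses b b'" "src b = tgt a"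
  shows "inverses (b \<cdot> a) (a' \<cdot> b')"
  using assms inverses_arr[OF assms(1)] inverses_arr[OF assms(2)]
  by (simp add: inverses_def[of "b \<cdot> a"] inverses_cancel)

lemma iso_morD:
  assumes "iso_mor C Y Y' b" "Y \<in> Obj C" "Y' \<in> Obj C"
  obtains b' where "inverses b b'" "src b = Y" "tgt b = Y'"
  using assms unfolding iso_mor_def by (auto simp: mor_iff inverses_def)

lemma iso_morI: "inverses b b' \<Longrightarrow> iso_mor C (src b) (tgt b) b"
  unfolding iso_mor_def by (intro conjI bexI[of _ b']) (auto simp: inverses_def mor_iff)

text \<open>
  The morphism \<open>w\<close> has the left inverse \<open>u \<cdot> w'\<close> and the right inverse \<open>w' \<cdot> v\<close>, and these agree.
\<close>

lemma inverses_from_compositions: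
  assumes "arr w" "arr w'" "src w' = tgt w" "tgt w' = src w"
    and "inverses (w' \<cdot> w) u" "inverses (w \<cdot> w') v"
  shows "inverses w (u \<cdot> w')"
proof -
  note u = inverses_arr[OF assms(5)] and v = inverses_arr[OF assms(6)]
  have left: "(u \<cdot> w') \<cdot> w = Idm C (src w)"
    using assms u by simp
  have "u \<cdot> w' = (u \<cdot> w') \<cdot> ((w \<cdot> w') \<cdot> v)"
    using assms u v by (simp del: assoc)
  also have "\<dots> = ((u \<cdot> w') \<cdot> w) \<cdot> (w' \<cdot> v)"
    using assms(1-4) u(2-4) v(2-4) by simp
  also have "\<dots> = w' \<cdot> v"
    unfolding left using assms v by simp
  finally show ?thesis
    using left assms u v by (simp add: inverses_def)
qed

text \<open>
  The product \<open>(1 + n) \<cdot> (1 - n) = 1 - n\<^sup>2\<close> is the identity.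
\<close>

lemma unipotent_inverses:
  assumes "arr n" "src n = X" "tgt n = X" "n \<cdot> n = zero X X"
  shows "inverses (Idm C X \<boxplus> n) (Idm C X \<boxplus> \<boxminus> n)"
  using assms arr_objects[of n] by (simp add: inverses_def add_assoc)

subsection \<open>Direct sums\<close>

lemma dsum_simps [simp]:
  assumes "A \<in> Obj C" "B \<in> Obj C"
  shows "dsum C A B \<in> Obj C"
    "arr (in1 (bip C A B))" "src (in1 (bip C A B)) = A" "tgt (in1 (bip C A B)) = dsum C A B"
    "arr (in2 (bip C A B))" "src (in2 (bip C A B)) = B" "tgt (in2 (bip C A B)) = dsum C A B"
    "arr (pr1 (bip C A B))" "src (pr1 (bip C A B)) = dsum C A B" "tgt (pr1 (bip C A B)) = A"
    "arr (pr2 (bip C A B))" "src (pr2 (bip C A B)) = dsum C A B" "tgt (pr2 (bip C A B)) = B"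
    "pr1 (bip C A B) \<cdot> in1 (bip C A B) = Idm C A" "pr2 (bip C A B) \<cdot> in2 (bip C A B) = Idm C B"
    "pr1 (bip C A B) \<cdot> in2 (bip C A B) = zero B A" "pr2 (bip C A B) \<cdot> in1 (bip C A B) = zero A B"
proof -
  have b: "is_biproduct C A B (bip C A B)" by (rule bip_is_biproduct[OF assms])
  then show o: "dsum C A B \<in> Obj C"
    by (simp add: is_biproduct_def)
  show "arr (in1 (bip C A B))" "src (in1 (bip C A B)) = A" "tgt (in1 (bip C A B)) = dsum C A B"
    "arr (in2 (bip C A B))" "src (in2 (bip C A B)) = B" "tgt (in2 (bip C A B)) = dsum C A B"
    "arr (pr1 (bip C A B))" "src (pr1 (bip C A B)) = dsum C A B" "tgt (pr1 (bip C A B)) = A"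
    "arr (pr2 (bip C A B))" "src (pr2 (bip C A B)) = dsum C A B" "tgt (pr2 (bip C A B)) = B"
    using b o assms by (simp_all add: is_biproduct_def mor_iff)
  show "pr1 (bip C A B) \<cdot> in1 (bip C A B) = Idm C A" "pr2 (bip C A B) \<cdot> in2 (bip C A B) = Idm C B"
    "pr1 (bip C A B) \<cdot> in2 (bip C A B) = zero B A" "pr2 (bip C A B) \<cdot> in1 (bip C A B) = zero A B"
    using b by (simp_all add: is_biproduct_def)
qed

lemma dsum_id:
  assumes "A \<in> Obj C" "B \<in> Obj C"
  shows "in1 (bip C A B) \<cdot> pr1 (bip C A B) \<boxplus> in2 (bip C A B) \<cdot> pr2 (bip C A B) = Idm C (dsum C A B)"
  using bip_is_biproduct[OF assms] assms by (simp add: is_biproduct_def add_fold)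

lemma dsum_comp_simps [simp]:
  assumes "A \<in> Obj C" "B \<in> Obj C" "arr h"
  shows "tgt h = A \<Longrightarrow> pr1 (bip C A B) \<cdot> (in1 (bip C A B) \<cdot> h) = h"
    "tgt h = B \<Longrightarrow> pr2 (bip C A B) \<cdot> (in2 (bip C A B) \<cdot> h) = h"
    "tgt h = B \<Longrightarrow> pr1 (bip C A B) \<cdot> (in2 (bip C A B) \<cdot> h) = zero (src h) A"
    "tgt h = A \<Longrightarrow> pr2 (bip C A B) \<cdot> (in1 (bip C A B) \<cdot> h) = zero (src h) B"
  using assms by (simp_all flip: assoc)

text \<open>
  Equations between matrices are checked entry by entry: multiplying the decomposition
  \<open>in\<^sub>1 \<cdot> pr\<^sub>1 + in\<^sub>2 \<cdot> pr\<^sub>2\<close> of the identity of \<open>A \<oplus> B\<close> by a morphism into (or out of) \<open>A \<oplus> B\<close> recovers the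
  morphism from its components.
\<close>

lemma into_dsum_eqI:
  assumes "A \<in> Obj C" "B \<in> Obj C" "arr u" "arr v" "src u = src v"
    "tgt u = dsum C A B" "tgt v = dsum C A B"
    "pr1 (bip C A B) \<cdot> u = pr1 (bip C A B) \<cdot> v" "pr2 (bip C A B) \<cdot> u = pr2 (bip C A B) \<cdot> v"
  shows "u = v"
proof -
  have "w = in1 (bip C A B) \<cdot> (pr1 (bip C A B) \<cdot> w) \<boxplus> in2 (bip C A B) \<cdot> (pr2 (bip C A B) \<cdot> w)"
    if "arr w" "tgt w = dsum C A B" for w
    using that assms(1,2) arg_cong[OF dsum_id[OF assms(1,2)], of "\<lambda>e. e \<cdot> w"] by simp
  then show ?thesis using assms by metis
qed

lemma from_dsum_eqI:
  assumes "A \<in> Obj C" "B \<in> Obj C" "arr u" "arr v" "tgt u = tgt v"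
    "src u = dsum C A B" "src v = dsum C A B"
    "u \<cdot> in1 (bip C A B) = v \<cdot> in1 (bip C A B)" "u \<cdot> in2 (bip C A B) = v \<cdot> in2 (bip C A B)"
  shows "u = v"
proof -
  have "w = (w \<cdot> in1 (bip C A B)) \<cdot> pr1 (bip C A B) \<boxplus> (w \<cdot> in2 (bip C A B)) \<cdot> pr2 (bip C A B)"
    if "arr w" "src w = dsum C A B" for w
    using that assms(1,2) arg_cong[OF dsum_id[OF assms(1,2)], of "\<lambda>e. w \<cdot> e"] by simp
  then show ?thesis using assms by metis
qed

lemma col_simps [simp]:
  assumes "arr f" "arr g" "src f = X" "src g = X" "tgt f = A" "tgt g = B"
  shows "arr (col C X A B f g)" "src (col C X A B f g) = X" "tgt (col C X A B f g) = dsum C A B"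
    "pr1 (bip C A B) \<cdot> col C X A B f g = f" "pr2 (bip C A B) \<cdot> col C X A B f g = g"
    "\<lbrakk>arr h; tgt h = X\<rbrakk> \<Longrightarrow> pr1 (bip C A B) \<cdot> (col C X A B f g \<cdot> h) = f \<cdot> h"
    "\<lbrakk>arr h; tgt h = X\<rbrakk> \<Longrightarrow> pr2 (bip C A B) \<cdot> (col C X A B f g \<cdot> h) = g \<cdot> h"
proof -
  have AB: "A \<in> Obj C" "B \<in> Obj C" "X \<in> Obj C" using assms by auto
  then have c: "col C X A B f g = in1 (bip C A B) \<cdot> f \<boxplus> in2 (bip C A B) \<cdot> g"
    using assms by (simp add: col_def add_fold)
  show "arr (col C X A B f g)" "src (col C X A B f g) = X" "tgt (col C X A B f g) = dsum C A B"
    "pr1 (bip C A B) \<cdot> col C X A B f g = f" "pr2 (bip C A B) \<cdot> col C X A B f g = g"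
    unfolding c using assms AB by simp_all
  then show "pr1 (bip C A B) \<cdot> (col C X A B f g \<cdot> h) = f \<cdot> h"
    "pr2 (bip C A B) \<cdot> (col C X A B f g \<cdot> h) = g \<cdot> h" if "arr h" "tgt h = X"
    using that AB by (simp_all flip: assoc)
qed

lemma row_simps [simp]:
  assumes "arr f" "arr g" "tgt f = Y" "tgt g = Y" "src f = A" "src g = B"
  shows "arr (row C A B Y f g)" "tgt (row C A B Y f g) = Y" "src (row C A B Y f g) = dsum C A B"
    "row C A B Y f g \<cdot> in1 (bip C A B) = f" "row C A B Y f g \<cdot> in2 (bip C A B) = g"
    "\<lbrakk>arr h; tgt h = A\<rbrakk> \<Longrightarrow> row C A B Y f g \<cdot> (in1 (bip C A B) \<cdot> h) = f \<cdot> h"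
    "\<lbrakk>arr h; tgt h = B\<rbrakk> \<Longrightarrow> row C A B Y f g \<cdot> (in2 (bip C A B) \<cdot> h) = g \<cdot> h"
proof -
  have AB: "A \<in> Obj C" "B \<in> Obj C" "Y \<in> Obj C" using assms by auto
  then have c: "row C A B Y f g = f \<cdot> pr1 (bip C A B) \<boxplus> g \<cdot> pr2 (bip C A B)"
    using assms by (simp add: row_def add_fold)
  show "arr (row C A B Y f g)" "tgt (row C A B Y f g) = Y" "src (row C A B Y f g) = dsum C A B"
    "row C A B Y f g \<cdot> in1 (bip C A B) = f" "row C A B Y f g \<cdot> in2 (bip C A B) = g"
    unfolding c using assms AB by simp_all
  then show "\<lbrakk>arr h; tgt h = A\<rbrakk> \<Longrightarrow> row C A B Y f g \<cdot> (in1 (bip C A B) \<cdot> h) = f \<cdot> h"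
    "\<lbrakk>arr h; tgt h = B\<rbrakk> \<Longrightarrow> row C A B Y f g \<cdot> (in2 (bip C A B) \<cdot> h) = g \<cdot> h" for h
    using AB by (simp_all flip: assoc)
qed

lemma diag_simps [simp]:
  assumes "arr f" "arr g" "src f = A" "src g = B" "tgt f = A'" "tgt g = B'"
  shows "arr (diag_mor C A B A' B' f g)"
    "src (diag_mor C A B A' B' f g) = dsum C A B" "tgt (diag_mor C A B A' B' f g) = dsum C A' B'"
    "diag_mor C A B A' B' f g \<cdot> in1 (bip C A B) = in1 (bip C A' B') \<cdot> f"
    "diag_mor C A B A' B' f g \<cdot> in2 (bip C A B) = in2 (bip C A' B') \<cdot> g"
    "pr1 (bip C A' B') \<cdot> diag_mor C A B A' B' f g = f \<cdot> pr1 (bip C A B)"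
    "pr2 (bip C A' B') \<cdot> diag_mor C A B A' B' f g = g \<cdot> pr2 (bip C A B)"
    "\<lbrakk>arr h; tgt h = A\<rbrakk> \<Longrightarrow>
       diag_mor C A B A' B' f g \<cdot> (in1 (bip C A B) \<cdot> h) = in1 (bip C A' B') \<cdot> (f \<cdot> h)"
    "\<lbrakk>arr h; tgt h = B\<rbrakk> \<Longrightarrow>
       diag_mor C A B A' B' f g \<cdot> (in2 (bip C A B) \<cdot> h) = in2 (bip C A' B') \<cdot> (g \<cdot> h)"
    "\<lbrakk>arr h; tgt h = dsum C A B\<rbrakk> \<Longrightarrow>
       pr1 (bip C A' B') \<cdot> (diag_mor C A B A' B' f g \<cdot> h) = f \<cdot> (pr1 (bip C A B) \<cdot> h)"
    "\<lbrakk>arr h; tgt h = dsum C A B\<rbrakk> \<Longrightarrow>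
       pr2 (bip C A' B') \<cdot> (diag_mor C A B A' B' f g \<cdot> h) = g \<cdot> (pr2 (bip C A B) \<cdot> h)"
proof -
  let ?d = "diag_mor C A B A' B' f g"
  have O: "A \<in> Obj C" "B \<in> Obj C" "A' \<in> Obj C" "B' \<in> Obj C" using assms by auto
  then have c: "?d = in1 (bip C A' B') \<cdot> (f \<cdot> pr1 (bip C A B)) \<boxplus> in2 (bip C A' B') \<cdot> (g \<cdot> pr2 (bip C A B))"
    using assms by (simp add: diag_mor_def add_fold)
  show a: "arr ?d" "src ?d = dsum C A B" "tgt ?d = dsum C A' B'"
    "?d \<cdot> in1 (bip C A B) = in1 (bip C A' B') \<cdot> f" "?d \<cdot> in2 (bip C A B) = in2 (bip C A' B') \<cdot> g"
    "pr1 (bip C A' B') \<cdot> ?d = f \<cdot> pr1 (bip C A B)" "pr2 (bip C A' B') \<cdot> ?d = g \<cdot> pr2 (bip C A B)"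
    unfolding c using assms O by simp_all
  show "?d \<cdot> (in1 (bip C A B) \<cdot> h) = in1 (bip C A' B') \<cdot> (f \<cdot> h)" if "arr h" "tgt h = A" for h
    using assoc[of h "in1 (bip C A B)" ?d] a that O assms by simp
  show "?d \<cdot> (in2 (bip C A B) \<cdot> h) = in2 (bip C A' B') \<cdot> (g \<cdot> h)" if "arr h" "tgt h = B" for h
    using assoc[of h "in2 (bip C A B)" ?d] a that O assms by simp
  show "pr1 (bip C A' B') \<cdot> (?d \<cdot> h) = f \<cdot> (pr1 (bip C A B) \<cdot> h)"
    "pr2 (bip C A' B') \<cdot> (?d \<cdot> h) = g \<cdot> (pr2 (bip C A B) \<cdot> h)" if "arr h" "tgt h = dsum C A B" for h
    using assoc[of h ?d "pr1 (bip C A' B')"] assoc[of h ?d "pr2 (bip C A' B')"] a that O assms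
    by simp_all
qed

lemma row_comp_col [simp]:
  assumes "arr f" "arr g" "arr u" "arr v" "tgt f = Y" "tgt g = Y" "src f = A" "src g = B"
    "src u = X" "src v = X" "tgt u = A" "tgt v = B"
  shows "row C A B Y f g \<cdot> col C X A B u v = f \<cdot> u \<boxplus> g \<cdot> v"
proof -
  have o: "A \<in> Obj C" "B \<in> Obj C" "X \<in> Obj C" using assms by auto
  then have "col C X A B u v = in1 (bip C A B) \<cdot> u \<boxplus> in2 (bip C A B) \<cdot> v"
    using assms by (simp add: col_def add_fold)
  then show ?thesis using assms o by simp
qed

lemma zero_object_obtain:
  obtains N where "N \<in> Obj C" "Idm C N = zero N N"
proof -
  obtain N where "is_zero_object C N" using zero_object by blast
  then have N: "N \<in> Obj C" and "\<exists>!f. f \<in> mor C N N" by (auto simp: is_zero_object_def)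
  then have "Idm C N = zero N N"
    using arr_mor[of "Idm C N"] arr_mor[of "zero N N"] by auto
  with N show ?thesis by (rule that)
qed

text \<open>
  An object whose identity is zero is a zero object, since \<open>h = 1 \<cdot> h\<close>.
\<close>

lemma to_zero:
  assumes "Idm C N = zero N N" "arr h" "tgt h = N"
  shows "h = zero (src h) N"
  using comp_id(1)[of h N] assms arr_objects[OF assms(2)] by simp

end

section \<open>Arithmetic of extensions\<close>

text \<open>
  All actions on extensions are kept in the two-sided form \<open>Emap C g f\<close>, so that any composite of
  pushouts and pullbacks collapses to a single one and the order of the two sides is immaterial.
\<close>

context additive_bifunctor
begin

abbreviation ext_zero :: "'o \<Rightarrow> 'o \<Rightarrow> 'e" where
  "ext_zero Z X \<equiv> \<one>\<^bsub>Ext C Z X\<^esub>"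

lemma ext_zero_closed [simp]: "\<lbrakk>Z \<in> Obj C; X \<in> Obj C\<rbrakk> \<Longrightarrow> ext_zero Z X \<in> ext C Z X"
  using ext_group[of Z X] by (simp add: comm_group_def group.is_monoid monoid.one_closed)

lemma ext_add_closed [simp]:
  "\<lbrakk>Z \<in> Obj C; X \<in> Obj C; d \<in> ext C Z X; d' \<in> ext C Z X\<rbrakk> \<Longrightarrow> d \<otimes>\<^bsub>Ext C Z X\<^esub> d' \<in> ext C Z X"
  using ext_group[of Z X] by (simp add: comm_group_def group.is_monoid monoid.m_closed)

lemma ext_add_zero [simp]:
  "\<lbrakk>Z \<in> Obj C; X \<in> Obj C; d \<in> ext C Z X\<rbrakk> \<Longrightarrow> d \<otimes>\<^bsub>Ext C Z X\<^esub> ext_zero Z X = d"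
  "\<lbrakk>Z \<in> Obj C; X \<in> Obj C; d \<in> ext C Z X\<rbrakk> \<Longrightarrow> ext_zero Z X \<otimes>\<^bsub>Ext C Z X\<^esub> d = d"
  using ext_group[of Z X] by (simp_all add: comm_group_def group.is_monoid monoid.r_one monoid.l_one)

lemma emap_closed [simp]:
  assumes "arr g" "arr f" "d \<in> ext C (tgt g) (src f)" "src g = Z" "tgt f = X"
  shows "Emap C g f d \<in> ext C Z X"
  using assms emap_hom[of "tgt g" "src g" "src f" "tgt f" g f] by (auto simp: hom_def mor_iff)

lemma emap_emap [simp]:
  assumes "arr g" "arr f" "arr g'" "arr f'" "tgt g' = src g" "src f' = tgt f"
    "d \<in> ext C (tgt g) (src f)"
  shows "Emap C g' f' (Emap C g f d) = Emap C (g \<cdot> g') (f' \<cdot> f) d"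
  using assms emap_comp[of "tgt g" "src g" "src g'" "src f" "tgt f" "tgt f'" g g' f f' d]
  by (simp add: mor_iff)

declare emap_id [simp]

lemma emap_ext_add [simp]:
  assumes "arr g" "arr f" "tgt g = Z" "src f = X" "d \<in> ext C Z X" "d' \<in> ext C Z X"
  shows "Emap C g f (d \<otimes>\<^bsub>Ext C Z X\<^esub> d') =
    Emap C g f d \<otimes>\<^bsub>Ext C (src g) (tgt f)\<^esub> Emap C g f d'"
  using assms emap_hom[of "tgt g" "src g" "src f" "tgt f" g f] by (auto simp: hom_def mor_iff)

lemma emap_ext_zero [simp]:
  assumes "arr g" "arr f" "tgt g = Z" "src f = X"
  shows "Emap C g f (ext_zero Z X) = ext_zero (src g) (tgt f)"
proof (rule hom_one)
  show "Emap C g f \<in> hom (Ext C Z X) (Ext C (src g) (tgt f))"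
    using assms by (intro emap_hom) (auto simp: mor_iff)
qed (use assms in \<open>auto intro!: ext_group comm_group.axioms(2)\<close>)

lemma emap_hom_right:
  assumes "arr g" "X \<in> Obj C" "X' \<in> Obj C" "d \<in> ext C (tgt g) X"
  shows "(\<lambda>f. Emap C g f d) \<in> hom (Hom C X X') (Ext C (src g) X')"
proof -
  have "(\<lambda>f. push C (src g) f (Emap C g (Idm C X) d)) \<in> hom (Hom C X X') (Ext C (src g) X')"
    using assms by (intro push_additive) auto
  moreover have "push C (src g) f (Emap C g (Idm C X) d) = Emap C g f d" if "f \<in> mor C X X'" for f
    using that assms by (simp add: push_def mor_iff)
  ultimately show ?thesis
    using assms hom_group[of X X'] monoid.m_closed[of "Hom C X X'"]
    by (auto simp: hom_def Pi_iff comm_group_def group_def)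
qed

lemma emap_hom_left:
  assumes "arr f" "Z \<in> Obj C" "Z' \<in> Obj C" "d \<in> ext C Z (src f)"
  shows "(\<lambda>g. Emap C g f d) \<in> hom (Hom C Z' Z) (Ext C Z' (tgt f))"
proof -
  have "(\<lambda>g. pull C (tgt f) g (Emap C (Idm C Z) f d)) \<in> hom (Hom C Z' Z) (Ext C Z' (tgt f))"
    using assms by (intro pull_additive) auto
  moreover have "pull C (tgt f) g (Emap C (Idm C Z) f d) = Emap C g f d" if "g \<in> mor C Z' Z" for g
    using that assms by (simp add: pull_def mor_iff)
  ultimately show ?thesis
    using assms hom_group[of Z' Z] monoid.m_closed[of "Hom C Z' Z"]
    by (auto simp: hom_def Pi_iff comm_group_def group_def)
qed

lemma emap_add_right [simp]:
  assumes "arr g" "arr f" "arr f'" "src f = src f'" "tgt f = tgt f'" "d \<in> ext C (tgt g) (src f')"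
  shows "Emap C g (f \<boxplus> f') d = Emap C g f d \<otimes>\<^bsub>Ext C (src g) (tgt f')\<^esub> Emap C g f' d"
  using hom_mult[OF emap_hom_right[of g "src f'" "tgt f'" d], of f f'] assms
  by (simp add: mor_iff add_fold)

lemma emap_add_left [simp]:
  assumes "arr f" "arr g" "arr g'" "src g = src g'" "tgt g = tgt g'" "d \<in> ext C (tgt g') (src f)"
  shows "Emap C (g \<boxplus> g') f d = Emap C g f d \<otimes>\<^bsub>Ext C (src g') (tgt f)\<^esub> Emap C g' f d"
  using hom_mult[OF emap_hom_left[of f "tgt g'" "src g'" d], of g g'] assms
  by (simp add: mor_iff add_fold)

lemma emap_zero_right [simp]:
  assumes "arr g" "X \<in> Obj C" "X' \<in> Obj C" "d \<in> ext C (tgt g) X"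
  shows "Emap C g (zero X X') d = ext_zero (src g) X'"
  using assms
  by (intro hom_one[OF emap_hom_right]) (auto intro!: ext_group hom_group comm_group.axioms(2))

lemma emap_zero_left [simp]:
  assumes "arr f" "Z \<in> Obj C" "Z' \<in> Obj C" "d \<in> ext C Z (src f)"
  shows "Emap C (zero Z' Z) f d = ext_zero Z' (tgt f)"
  using assms
  by (intro hom_one[OF emap_hom_left]) (auto intro!: ext_group hom_group comm_group.axioms(2))

lemma ext_sum_closed [simp]:
  assumes "Z \<in> Obj C" "X \<in> Obj C" "Z' \<in> Obj C" "X' \<in> Obj C" "d \<in> ext C Z X" "d' \<in> ext C Z' X'"
  shows "ext_sum C Z X d Z' X' d' \<in> ext C (dsum C Z Z') (dsum C X X')"
  using assms by (simp add: ext_sum_def)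

lemma emap_ext_sum [simp]:
  assumes "Z \<in> Obj C" "X \<in> Obj C" "Z' \<in> Obj C" "X' \<in> Obj C" "d \<in> ext C Z X" "d' \<in> ext C Z' X'"
    "arr g" "arr f" "tgt g = dsum C Z Z'" "src f = dsum C X X'"
  shows "Emap C g f (ext_sum C Z X d Z' X' d') =
    Emap C (pr1 (bip C Z Z') \<cdot> g) (f \<cdot> in1 (bip C X X')) d \<otimes>\<^bsub>Ext C (src g) (tgt f)\<^esub>
    Emap C (pr2 (bip C Z Z') \<cdot> g) (f \<cdot> in2 (bip C X X')) d'"
  using assms by (simp add: ext_sum_def)

end

section \<open>Triangles\<close>

declare E_triangle.simps [simp del] E_morphism.simps [simp del]

context additive_realization
begin

lemma triangle_arr:
  assumes "E_triangle C (X, f, Y, g, Z, d)"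
  shows "X \<in> Obj C" "Y \<in> Obj C" "Z \<in> Obj C" "arr f" "src f = X" "tgt f = Y"
    "arr g" "src g = Y" "tgt g = Z" "d \<in> ext C Z X"
proof -
  show o: "X \<in> Obj C" "Z \<in> Obj C" "d \<in> ext C Z X"
    using assms by (simp_all add: E_triangle.simps)
  then have "(f, Y, g) \<in> sequences C X Z"
    using real_class[of Z X d] assms by (auto simp: E_triangle.simps quotient_def seq_equiv_def)
  then show "Y \<in> Obj C" "arr f" "src f = X" "tgt f = Y" "arr g" "src g = Y" "tgt g = Z"
    using o by (auto simp: sequences_def mor_iff)
qed

lemma triangle_exists:
  assumes "Z \<in> Obj C" "X \<in> Obj C" "d \<in> ext C Z X"
  obtains f Y g where "E_triangle C (X, f, Y, g, Z, d)"
proof -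
  obtain f Y g where s: "(f, Y, g) \<in> sequences C X Z" "Real C Z X d = seq_equiv C X Z `` {(f, Y, g)}"
    using real_class[OF assms] by (auto elim!: quotientE)
  then have "Y \<in> Obj C" by (simp add: sequences_def)
  then have "((f, Y, g), (f, Y, g)) \<in> seq_equiv C X Z"
    using s(1) assms iso_morI[OF inverses_id[of Y]]
    by (auto simp: seq_equiv_def sequences_def mor_iff intro!: exI[of _ "Idm C Y"])
  then show ?thesis
    using s assms that[of f Y g] by (simp add: E_triangle.simps)
qed

text \<open>
  A realization is a whole equivalence class, and isomorphisms of middle terms compose.
\<close>

lemma triangle_equiv:
  assumes T: "E_triangle C (X, f, Y, g, Z, d)" and b: "inverses b b'" "src b = Y" "tgt b = Y'"
    and f': "f' = b \<cdot> f" and g': "arr g'" "src g' = Y'" "g' \<cdot> b = g"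
  shows "E_triangle C (X, f', Y', g', Z, d)"
proof -
  note T' = triangle_arr[OF T] and b' = inverses_arr[OF b(1)]
  have Y': "Y' \<in> Obj C" using b b' by auto
  have t: "tgt g' = Z" using g' b b' T' by (metis arr_comp(3))
  obtain f\<^sub>0 Y\<^sub>0 g\<^sub>0 where s: "Real C Z X d = seq_equiv C X Z `` {(f\<^sub>0, Y\<^sub>0, g\<^sub>0)}"
    using real_class[of Z X d] T' by (auto elim!: quotientE)
  then have "((f\<^sub>0, Y\<^sub>0, g\<^sub>0), (f, Y, g)) \<in> seq_equiv C X Z"
    using T by (simp add: E_triangle.simps)
  then obtain h where seqs: "(f\<^sub>0, Y\<^sub>0, g\<^sub>0) \<in> sequences C X Z"
    and h: "iso_mor C Y\<^sub>0 Y h" "h \<cdot> f\<^sub>0 = f" "g \<cdot> h = g\<^sub>0"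
    by (auto simp: seq_equiv_def)
  then have a: "Y\<^sub>0 \<in> Obj C" "arr f\<^sub>0" "src f\<^sub>0 = X" "tgt f\<^sub>0 = Y\<^sub>0" "arr g\<^sub>0" "src g\<^sub>0 = Y\<^sub>0" "tgt g\<^sub>0 = Z"
    using T' by (auto simp: sequences_def mor_iff)
  obtain h' where h': "inverses h h'" "src h = Y\<^sub>0" "tgt h = Y"
    using h(1) a T' by (auto elim: iso_morD)
  note h'' = inverses_arr[OF h'(1)]
  have "iso_mor C Y\<^sub>0 Y' (b \<cdot> h)"
    using iso_morI[OF inverses_comp[OF h'(1) b(1)]] h'' h' b b' by simp
  moreover have "(b \<cdot> h) \<cdot> f\<^sub>0 = f'" "g' \<cdot> (b \<cdot> h) = g\<^sub>0"
    using h h' h'' a b b' f' g' by (simp, simp flip: assoc)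
  moreover have "(f', Y', g') \<in> sequences C X Z"
    using T' b b' Y' t f' g' by (simp add: sequences_def mor_iff)
  ultimately have "((f\<^sub>0, Y\<^sub>0, g\<^sub>0), (f', Y', g')) \<in> seq_equiv C X Z"
    using seqs by (auto simp: seq_equiv_def)
  then show ?thesis
    using T' s by (simp add: E_triangle.simps)
qed

lemma zero_triangle:
  "\<lbrakk>X \<in> Obj C; Z \<in> Obj C\<rbrakk>
    \<Longrightarrow> E_triangle C (X, in1 (bip C X Z), dsum C X Z, pr2 (bip C X Z), Z, ext_zero Z X)"
  using real_zero by (simp add: E_triangle.simps)

text \<open>
  The morphisms \<open>f\<close>, \<open>i\<close> and \<open>r\<close>, \<open>g\<close> make \<open>Y\<close> a direct sum of \<open>X\<close> and \<open>Z\<close>, so the sequence is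
  equivalent to the standard split sequence, which realizes zero.
\<close>

lemma split_triangle:
  assumes "arr f" "src f = X" "tgt f = Y" "arr g" "src g = Y" "tgt g = Z"
    and "arr r" "src r = Y" "tgt r = X" "arr i" "src i = Z" "tgt i = Y"
    and "r \<cdot> f = Idm C X" "g \<cdot> i = Idm C Z" "g \<cdot> f = zero X Z" "r \<cdot> i = zero Z X"
    and "f \<cdot> r \<boxplus> i \<cdot> g = Idm C Y"
  shows "E_triangle C (X, f, Y, g, Z, ext_zero Z X)"
proof -
  have o: "X \<in> Obj C" "Y \<in> Obj C" "Z \<in> Obj C" using assms by auto
  let ?b = "f \<cdot> pr1 (bip C X Z) \<boxplus> i \<cdot> pr2 (bip C X Z)"
  let ?b' = "in1 (bip C X Z) \<cdot> r \<boxplus> in2 (bip C X Z) \<cdot> g"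
  have "?b' \<cdot> ?b = Idm C (dsum C X Z)"
    by (rule into_dsum_eqI[of X Z]) (use assms o in \<open>simp_all flip: assoc\<close>)
  then have b: "inverses ?b ?b'"
    using assms o by (simp add: inverses_def)
  have "g \<cdot> ?b = pr2 (bip C X Z)"
    using assms o comp_eq_comp[OF assms(14)] comp_eq_comp[OF assms(15)] by simp
  then show ?thesis
    using assms o by (intro triangle_equiv[OF zero_triangle[OF o(1,3)] b]) simp_all
qed

lemma triangle_sum:
  assumes T: "E_triangle C (X, f, Y, g, Z, d)" and T': "E_triangle C (X', f', Y', g', Z', d')"
  shows "E_triangle C (dsum C X X', diag_mor C X X' Y Y' f f', dsum C Y Y',
    diag_mor C Y Y' Z Z' g g', dsum C Z Z', ext_sum C Z X d Z' X' d')"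
  using assms triangle_arr[OF T] triangle_arr[OF T'] real_sum[of Z X Z' X' d d' f Y g f' Y' g']
  by (simp add: E_triangle.simps)

lemma triangle_morphism:
  assumes T: "E_triangle C (X, f, Y, g, Z, d)" and T': "E_triangle C (X', f', Y', g', Z', d')"
    and "arr a" "src a = X" "tgt a = X'" "arr c" "src c = Z" "tgt c = Z'"
    and "Emap C (Idm C Z) a d = Emap C c (Idm C X') d'"
  obtains b where "arr b" "src b = Y" "tgt b = Y'" "b \<cdot> f = f' \<cdot> a" "g' \<cdot> b = c \<cdot> g"
  using assms triangle_arr[OF T] triangle_arr[OF T']
    real_morphism[of Z X Z' X' d d' a c f Y g f' Y' g']
  by (auto simp: E_triangle.simps mor_iff push_def pull_def)

lemma E_morphism_iff:
  assumes "E_triangle C (X, f, Y, g, Z, d)" "E_triangle C (X', f', Y', g', Z', d')"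
  shows "E_morphism C (X, f, Y, g, Z, d) (X', f', Y', g', Z', d') (a, b, c) \<longleftrightarrow>
     arr a \<and> src a = X \<and> tgt a = X' \<and> arr b \<and> src b = Y \<and> tgt b = Y' \<and>
     arr c \<and> src c = Z \<and> tgt c = Z' \<and> b \<cdot> f = f' \<cdot> a \<and> g' \<cdot> b = c \<cdot> g \<and>
     Emap C (Idm C Z) a d = Emap C c (Idm C X') d'"
  using assms triangle_arr[OF assms(1)] triangle_arr[OF assms(2)]
  by (auto simp: E_morphism.simps mor_iff push_def pull_def)

end

context extriangulated_category
begin

text \<open>
  Exactness of \<open>Hom(-, W)\<close> at the middle term, by comparison with a split sequence that ends in \<open>W\<close>:
  the pair \<open>(0, in\<^sub>2 \<cdot> n)\<close> extends to a morphism of triangles, whose last component is the required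
  factor.
\<close>

lemma inflation_factor:
  assumes T: "E_triangle C (X, f, Y, g, Z, d)"
    and n: "arr n" "src n = Y" "tgt n = W" "n \<cdot> f = zero X W"
  obtains c where "arr c" "src c = Z" "tgt c = W" "c \<cdot> g = n"
proof -
  note t = triangle_arr[OF T]
  have W: "W \<in> Obj C" using n by auto
  have S: "E_triangle C (W, in1 (bip C W W), dsum C W W, pr2 (bip C W W), W, ext_zero W W)"
    using W by (intro zero_triangle)
  obtain c where "E_morphism C (X, f, Y, g, Z, d)
      (W, in1 (bip C W W), dsum C W W, pr2 (bip C W W), W, ext_zero W W)
      (zero X W, in2 (bip C W W) \<cdot> n, c)"
    using ET3[OF T S, of "zero X W" "in2 (bip C W W) \<cdot> n"] t n W by (auto simp: mor_iff)
  then show ?thesis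
    using that[of c] n W t by (auto simp: E_morphism_iff[OF T S])
qed

text \<open>
  Comparison with the split sequence of \<open>X \<oplus> X\<close> through \<open>f \<cdot> pr\<^sub>1\<close> gives \<open>c\<close> with
  \<open>g \<cdot> f \<cdot> pr\<^sub>1 = c \<cdot> pr\<^sub>2\<close>, and \<open>in\<^sub>1\<close> turns this into \<open>g \<cdot> f = 0\<close>.
\<close>

lemma triangle_comp_zero:
  assumes T: "E_triangle C (X, f, Y, g, Z, d)"
  shows "g \<cdot> f = zero X Z"
proof -
  note t = triangle_arr[OF T]
  have S: "E_triangle C (X, in1 (bip C X X), dsum C X X, pr2 (bip C X X), X, ext_zero X X)"
    using t by (intro zero_triangle)
  obtain c where "E_morphism C
      (X, in1 (bip C X X), dsum C X X, pr2 (bip C X X), X, ext_zero X X) (X, f, Y, g, Z, d)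
      (Idm C X, f \<cdot> pr1 (bip C X X), c)"
    using ET3[OF S T, of "Idm C X" "f \<cdot> pr1 (bip C X X)"] t by (auto simp: mor_iff)
  then have "arr c" "src c = X" "tgt c = Z" and "g \<cdot> (f \<cdot> pr1 (bip C X X)) = c \<cdot> pr2 (bip C X X)"
    by (simp_all add: E_morphism_iff[OF S T])
  from arg_cong[OF this(4), of "\<lambda>h. h \<cdot> in1 (bip C X X)"] this(1-3) show ?thesis
    using t by simp
qed

text \<open>
  The pair \<open>(pr\<^sub>2, g)\<close> from the split sequence \<open>X \<rightarrow> X \<oplus> Y \<rightarrow> Y\<close> extends to a morphism of triangles
  with some first component \<open>a\<close>, hence \<open>g\<^sup>*\<delta> = a\<^sub>*0 = 0\<close>.  The factors \<open>k\<close> and \<open>h\<close> make this applicable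
  inside any composite action on the extension.
\<close>

lemma emap_deflation:
  assumes T: "E_triangle C (X, f, Y, g, Z, d)" and "arr k" "tgt k = Y" "arr h" "src h = X"
  shows "Emap C (g \<cdot> k) h d = ext_zero (src k) (tgt h)"
proof -
  note t = triangle_arr[OF T]
  have S: "E_triangle C (X, in1 (bip C X Y), dsum C X Y, pr2 (bip C X Y), Y, ext_zero Y X)"
    using t by (intro zero_triangle)
  obtain a where "E_morphism C
      (X, in1 (bip C X Y), dsum C X Y, pr2 (bip C X Y), Y, ext_zero Y X) (X, f, Y, g, Z, d)
      (a, pr2 (bip C X Y), g)"
    using ET3_op[OF S T, of "pr2 (bip C X Y)" g] t by (auto simp: mor_iff)
  then have "Emap C g (Idm C X) d = ext_zero Y X"
    using t by (auto simp: E_morphism_iff[OF S T])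
  moreover have "Emap C (g \<cdot> k) h d = Emap C k h (Emap C g (Idm C X) d)"
    using t assms(2-) by simp
  ultimately show ?thesis
    using t assms(2-) by simp
qed

text \<open>
  Dually, the pair \<open>(f, in\<^sub>1)\<close> into the split sequence \<open>Y \<rightarrow> Y \<oplus> Z \<rightarrow> Z\<close> extends to a morphism of
  triangles, hence \<open>f\<^sub>*\<delta> = c\<^sup>*0 = 0\<close>.
\<close>

lemma emap_inflation:
  assumes T: "E_triangle C (X, f, Y, g, Z, d)" and "arr k" "tgt k = Z" "arr h" "src h = Y"
  shows "Emap C k (h \<cdot> f) d = ext_zero (src k) (tgt h)"
proof -
  note t = triangle_arr[OF T]
  have S: "E_triangle C (Y, in1 (bip C Y Z), dsum C Y Z, pr2 (bip C Y Z), Z, ext_zero Z Y)"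
    using t by (intro zero_triangle)
  obtain c where "E_morphism C (X, f, Y, g, Z, d)
      (Y, in1 (bip C Y Z), dsum C Y Z, pr2 (bip C Y Z), Z, ext_zero Z Y) (f, in1 (bip C Y Z), c)"
    using ET3[OF T S, of f "in1 (bip C Y Z)"] t by (auto simp: mor_iff)
  then have "Emap C (Idm C Z) f d = ext_zero Z Y"
    using t by (auto simp: E_morphism_iff[OF T S])
  moreover have "Emap C k (h \<cdot> f) d = Emap C k h (Emap C (Idm C Z) f d)"
    using t assms(2-) by simp
  ultimately show ?thesis
    using t assms(2-) by simp
qed

text \<open>
  The difference \<open>n = e - 1\<close> is killed by \<open>f\<close>, so it factors as \<open>n = c \<cdot> g\<close>; as \<open>g \<cdot> n = 0\<close>, its square
  is zero and \<open>e = 1 + n\<close> is invertible.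
\<close>

lemma middle_endomorphism_iso:
  assumes T: "E_triangle C (X, f, Y, g, Z, d)"
    and e: "arr e" "src e = Y" "tgt e = Y" "e \<cdot> f = f" "g \<cdot> e = g"
  obtains e' where "inverses e e'"
proof -
  note t = triangle_arr[OF T]
  let ?n = "e \<boxplus> \<boxminus> Idm C Y"
  have n: "arr ?n" "src ?n = Y" "tgt ?n = Y" "?n \<cdot> f = zero X Y" "g \<cdot> ?n = zero Y Z"
    using t e by simp_all
  obtain c where c: "arr c" "src c = Z" "tgt c = Y" "c \<cdot> g = ?n"
    using inflation_factor[OF T n(1-4)] .
  have "?n \<cdot> ?n = c \<cdot> (g \<cdot> ?n)"
    using assoc[OF n(1) t(7) c(1)] n c t by simp
  then have "?n \<cdot> ?n = zero Y Y"
    using n(5) c t by simp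
  moreover have "Idm C Y \<boxplus> ?n = e"
    using e t by (simp add: add_left_comm)
  ultimately show ?thesis
    using unipotent_inverses[OF n(1-3)] that by metis
qed

text \<open>
  Compare the given triangle with a realization \<open>X' \<rightarrow> W \<rightarrow> Z'\<close> of the new extension.  The axiom on
  morphisms of extensions gives maps \<open>w\<close> and \<open>w'\<close> between the middle terms in both directions; both
  composites fix the maps of a triangle, so \<open>w\<close> is an isomorphism by the previous lemma.  Then \<open>b\<close>
  after the inverse of \<open>w\<close> identifies the realization with the candidate sequence.
\<close>

lemma triangle_iso:
  assumes T: "E_triangle C (X, f, Y, g, Z, d)"
    and a: "inverses a a'" "src a = X" "tgt a = X'"
    and b: "inverses b b'" "src b = Y" "tgt b = Y'"
    and c: "inverses c c'" "src c = Z" "tgt c = Z'"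
    and f': "arr f'" "src f' = X'" "tgt f' = Y'" and g': "arr g'" "src g' = Y'" "tgt g' = Z'"
    and d': "d' \<in> ext C Z' X'"
    and sq: "b \<cdot> f = f' \<cdot> a" "g' \<cdot> b = c \<cdot> g" "Emap C (Idm C Z) a d = Emap C c (Idm C X') d'"
  shows "E_triangle C (X', f', Y', g', Z', d')"
proof -
  note t = triangle_arr[OF T] and ia = inverses_arr[OF a(1)] and ib = inverses_arr[OF b(1)]
    and ic = inverses_arr[OF c(1)]
  have o: "X' \<in> Obj C" "Y' \<in> Obj C" "Z' \<in> Obj C" using f' g' by auto
  obtain m W n where R: "E_triangle C (X', m, W, n, Z', d')"
    using triangle_exists[OF o(3,1) d'] .
  note r = triangle_arr[OF R]
  have "Emap C c' a' (Emap C (Idm C Z) a d) = Emap C c' a' (Emap C c (Idm C X') d')"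
    using sq(3) by simp
  then have sq': "Emap C (Idm C Z') a' d' = Emap C c' (Idm C X) d"
    using t r a ia c ic by simp
  obtain w where w: "arr w" "src w = Y" "tgt w = W" "w \<cdot> f = m \<cdot> a" "n \<cdot> w = c \<cdot> g"
    using triangle_morphism[OF T R _ _ _ _ _ _ sq(3)] ia ic a c by metis
  obtain w' where w': "arr w'" "src w' = W" "tgt w' = Y" "w' \<cdot> m = f \<cdot> a'" "g \<cdot> w' = c' \<cdot> n"
    using triangle_morphism[OF R T _ _ _ _ _ _ sq'] ia ic a c by metis
  have "(w' \<cdot> w) \<cdot> f = f" "g \<cdot> (w' \<cdot> w) = g" "(w \<cdot> w') \<cdot> m = m" "n \<cdot> (w \<cdot> w') = n"
    using w w' t r a ia c ic inverses_cancel[OF c(1)] comp_eq_comp[OF w(4)] comp_eq_comp[OF w(5)]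
      comp_eq_comp[OF w'(4)] comp_eq_comp[OF w'(5)] by simp_all
  then obtain u v where "inverses (w' \<cdot> w) u" "inverses (w \<cdot> w') v"
    using middle_endomorphism_iso[OF T, of "w' \<cdot> w"] middle_endomorphism_iso[OF R, of "w \<cdot> w'"] w w'
    by (metis arr_comp)
  then have "inverses w (u \<cdot> w')"
    using w w' by (intro inverses_from_compositions) auto
  then obtain x where x: "inverses w x" ..
  note ix = inverses_arr[OF x]
  have "x \<cdot> m = (x \<cdot> (m \<cdot> a)) \<cdot> a'"
    using t r a ia ix w by (simp del: w(4))
  also have "\<dots> = f \<cdot> a'"
    using inverses_cancel(1)[OF x, of f] t w by simp
  finally have xm: "x \<cdot> m = f \<cdot> a'" .
  have "g' \<cdot> (b \<cdot> x) = (n \<cdot> w) \<cdot> x"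
    using comp_eq_comp[OF sq(2), of x] t g' b ib ix w by (simp del: assoc)
  also have "\<dots> = n \<cdot> (w \<cdot> x)"
    using ix w r by (intro assoc) simp_all
  also have "\<dots> = n"
    using ix w r by simp
  finally have gx: "g' \<cdot> (b \<cdot> x) = n" .
  show ?thesis
  proof (rule triangle_equiv[OF R])
    show "inverses (b \<cdot> x) (w \<cdot> b')"
      using inverses_comp[OF inverses_sym[OF x] b(1)] ix w b by simp
  qed (use xm gx w ix ia ib a b t r f' g' comp_eq_comp[OF sq(1)] in simp_all)
qed

end

section \<open>Homotopic morphisms\<close>

context extriangulated_category
begin

lemma E_morphism_triangles:
  assumes "E_morphism C (X, f, Y, g, Z, d) (X', f', Y', g', Z', d') (a, b, c)"
  shows "E_triangle C (X, f, Y, g, Z, d)" "E_triangle C (X', f', Y', g', Z', d')"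
  using assms by (simp_all add: E_morphism.simps)

lemma E_morphismD:
  assumes m: "E_morphism C (X, f, Y, g, Z, d) (X', f', Y', g', Z', d') (a, b, c)"
  shows "arr a" "src a = X" "tgt a = X'" "arr b" "src b = Y" "tgt b = Y'"
    "arr c" "src c = Z" "tgt c = Z'" "b \<cdot> f = f' \<cdot> a" "g' \<cdot> b = c \<cdot> g"
    "Emap C (Idm C Z) a d = Emap C c (Idm C X') d'"
  using m[unfolded E_morphism_iff[OF E_morphism_triangles[OF m]]] by blast+

text \<open>
  The relation \<open>a\<^sub>*\<delta> = c\<^sup>*\<delta>'\<close>, in a form that can be used inside any composite action.
\<close>

lemma E_morphism_emap:
  assumes m: "E_morphism C (X, f, Y, g, Z, d) (X', f', Y', g', Z', d') (a, b, c)"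
    and "arr k" "tgt k = Z" "arr h" "src h = X'"
  shows "Emap C k (h \<cdot> a) d = Emap C (c \<cdot> k) h d'"
proof -
  note a = E_morphismD[OF m] triangle_arr[OF E_morphism_triangles(1)[OF m]]
    triangle_arr[OF E_morphism_triangles(2)[OF m]]
  have "Emap C k (h \<cdot> a) d = Emap C k h (Emap C (Idm C Z) a d)"
    using a(1-9,13-) assms(2-) by simp
  also have "\<dots> = Emap C (c \<cdot> k) h d'"
    unfolding a(12) using a(1-9,13-) assms(2-) by simp
  finally show ?thesis .
qed

lemma E_morphism_comp:
  assumes m: "E_morphism C (X, f, Y, g, Z, d) (X', f', Y', g', Z', d') (a, b, c)"
    and m': "E_morphism C (X', f', Y', g', Z', d') (X'', f'', Y'', g'', Z'', d'') (a', b', c')"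
  shows "E_morphism C (X, f, Y, g, Z, d) (X'', f'', Y'', g'', Z'', d'') (a' \<cdot> a, b' \<cdot> b, c' \<cdot> c)"
proof -
  note T = E_morphism_triangles[OF m] and T'' = E_morphism_triangles(2)[OF m']
  note t = triangle_arr[OF T(1)] triangle_arr[OF T(2)] triangle_arr[OF T'']
  note a = E_morphismD[OF m] and a' = E_morphismD[OF m']
  show ?thesis
    unfolding E_morphism_iff[OF T(1) T'']
    using t a a' comp_eq_comp[OF a'(10)] comp_eq_comp[OF a'(11)] E_morphism_emap[OF m, of "Idm C Z" a']
      E_morphism_emap[OF m', of c "Idm C X''"]
    by simp
qed

text \<open>
  The two halves of a homotopic morphism already compose to a morphism of triangles.
\<close>

lemma homotopicI:
  assumes m: "E_morphism C (X, f, Y, g, Z, d) (X', s, E, t, Z, e) (a, b\<^sub>1, Idm C Z)"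
    and m': "E_morphism C (X', s, E, t, Z, e) (X', f', Y', g', Z', d') (Idm C X', b\<^sub>2, c)"
    and t1: "E_triangle C (X, col C X Y X' f a, dsum C Y X', row C Y X' E b\<^sub>1 (\<boxminus> s), E,
      Emap C t (Idm C X) d)"
    and t2: "E_triangle C (E, col C E Z Y' (\<boxminus> t) b\<^sub>2, dsum C Z Y', row C Z Y' Z' c g', Z',
      Emap C (Idm C Z') s d')"
  shows "homotopic C (X, f, Y, g, Z, d) (X', f', Y', g', Z', d') (a, b\<^sub>2 \<cdot> b\<^sub>1, c)"
proof -
  note T = E_morphism_triangles[OF m] and T' = E_morphism_triangles[OF m']
  note a = triangle_arr[OF T(2)] E_morphismD(1-9)[OF m] E_morphismD(1-9)[OF m']
  have "E_morphism C (X, f, Y, g, Z, d) (X', f', Y', g', Z', d') (a, b\<^sub>2 \<cdot> b\<^sub>1, c)"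
    using E_morphism_comp[OF m m'] a by simp
  then show ?thesis
    unfolding homotopic.simps
    using m m' t1 t2 T a triangle_arr(2)[OF T(1)] triangle_arr(2)[OF T'(2)]
    by (intro conjI exI[of _ s] exI[of _ E] exI[of _ t] exI[of _ e] exI[of _ b\<^sub>1] exI[of _ b\<^sub>2])
      (simp_all add: push_def pull_def mor_iff)
qed

lemma homotopicE:
  assumes "homotopic C (X, f, Y, g, Z, d) (X', f', Y', g', Z', d') (a, b, c)"
  obtains s E t e b\<^sub>1 b\<^sub>2 where "b = b\<^sub>2 \<cdot> b\<^sub>1"
    "E_morphism C (X, f, Y, g, Z, d) (X', s, E, t, Z, e) (a, b\<^sub>1, Idm C Z)"
    "E_morphism C (X', s, E, t, Z, e) (X', f', Y', g', Z', d') (Idm C X', b\<^sub>2, c)"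
    "E_triangle C (X, col C X Y X' f a, dsum C Y X', row C Y X' E b\<^sub>1 (\<boxminus> s), E,
      Emap C t (Idm C X) d)"
    "E_triangle C (E, col C E Z Y' (\<boxminus> t) b\<^sub>2, dsum C Z Y', row C Z Y' Z' c g', Z',
      Emap C (Idm C Z') s d')"
proof -
  obtain s E t e b\<^sub>1 b\<^sub>2 where h: "E_triangle C (X', s, E, t, Z, e)" "b = b\<^sub>2 \<cdot> b\<^sub>1"
    "E_morphism C (X, f, Y, g, Z, d) (X', s, E, t, Z, e) (a, b\<^sub>1, Idm C Z)"
    "E_morphism C (X', s, E, t, Z, e) (X', f', Y', g', Z', d') (Idm C X', b\<^sub>2, c)"
    "E_triangle C (X, col C X Y X' f a, dsum C Y X',
          row C Y X' E b\<^sub>1 (inv\<^bsub>Hom C X' E\<^esub> s), E, pull C X t d)"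
    "E_triangle C (E, col C E Z Y' (inv\<^bsub>Hom C E Z\<^esub> t) b\<^sub>2, dsum C Z Y',
          row C Z Y' Z' c g', Z', push C Z' s d')"
    using assms unfolding homotopic.simps by blast
  show ?thesis
    using h triangle_arr[OF h(1)] by (intro that[of b\<^sub>2 b\<^sub>1 s E t e]) (simp_all add: push_def pull_def)
qed

lemma inverses_diag:
  assumes "inverses a a'" "inverses b b'" "src a = A" "src b = B" "tgt a = A'" "tgt b = B'"
  shows "inverses (diag_mor C A B A' B' a b) (diag_mor C A' B' A B a' b')"
proof -
  note a = inverses_arr[OF assms(1)] inverses_arr[OF assms(2)] assms(3-)
  have o: "A \<in> Obj C" "B \<in> Obj C" "A' \<in> Obj C" "B' \<in> Obj C"
    using a arr_objects by metis+
  have "diag_mor C A' B' A B a' b' \<cdot> diag_mor C A B A' B' a b = Idm C (dsum C A B)"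
    by (rule into_dsum_eqI[of A B]) (use a o inverses_cancel assms in simp_all)
  moreover have "diag_mor C A B A' B' a b \<cdot> diag_mor C A' B' A B a' b' = Idm C (dsum C A' B')"
    by (rule into_dsum_eqI[of A' B']) (use a o inverses_cancel assms in simp_all)
  ultimately show ?thesis
    using a o by (simp add: inverses_def)
qed

text \<open>
  The first half and the middle term \<open>E\<close> are kept; the intermediate triangle is pushed out along the
  isomorphism \<open>p\<close> of first terms, so that \<open>s\<close> becomes \<open>s \<cdot> p\<^sup>-\<^sup>1\<close>.  The two triangles over \<open>Y \<oplus> X'\<close> and
  \<open>Z \<oplus> Y'\<close> change by the isomorphisms \<open>1 \<oplus> p\<close> and \<open>1 \<oplus> q\<close> of their middle terms, and the last one
  also by \<open>r\<close> at its end.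
\<close>

lemma homotopic_iso:
  assumes hom: "homotopic C (X, f, Y, g, Z, d) (X', f', Y', g', Z', d') (a, b, c)"
    and m: "E_morphism C (X', f', Y', g', Z', d') (X'', f'', Y'', g'', Z'', d'') (p, q, r)"
    and p: "inverses p p'" and q: "inverses q q'" and r: "inverses r r'"
  shows "homotopic C (X, f, Y, g, Z, d) (X'', f'', Y'', g'', Z'', d'') (p \<cdot> a, q \<cdot> b, r \<cdot> c)"
proof -
  obtain s E t e b\<^sub>1 b\<^sub>2 where b: "b = b\<^sub>2 \<cdot> b\<^sub>1"
    and m1: "E_morphism C (X, f, Y, g, Z, d) (X', s, E, t, Z, e) (a, b\<^sub>1, Idm C Z)"
    and m2: "E_morphism C (X', s, E, t, Z, e) (X', f', Y', g', Z', d') (Idm C X', b\<^sub>2, c)"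
    and t1: "E_triangle C (X, col C X Y X' f a, dsum C Y X', row C Y X' E b\<^sub>1 (\<boxminus> s), E,
      Emap C t (Idm C X) d)"
    and t2: "E_triangle C (E, col C E Z Y' (\<boxminus> t) b\<^sub>2, dsum C Z Y', row C Z Y' Z' c g', Z',
      Emap C (Idm C Z') s d')"
    using homotopicE[OF hom] .
  note T = E_morphism_triangles[OF m1] and T'' = E_morphism_triangles[OF m]
  note arrs = triangle_arr[OF T(1)] triangle_arr[OF T(2)] triangle_arr[OF T''(1)]
    triangle_arr[OF T''(2)] inverses_arr[OF p] inverses_arr[OF q] inverses_arr[OF r]
  note D1 = E_morphismD[OF m1] and D2 = E_morphismD[OF m2] and D = E_morphismD[OF m]
  note types = arrs D1(1-9) D2(1-9) D(1-9)
  have M: "E_triangle C (X'', s \<cdot> p', E, t, Z, Emap C (Idm C Z) p e)"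
    by (rule triangle_iso[OF T(2) p _ _ inverses_id[of E] _ _ inverses_id[of Z]]) (use types in simp_all)
  have push_e: "Emap C (Idm C Z) p e = Emap C (r \<cdot> c) (Idm C X'') d''"
    using E_morphism_emap[OF m2, of "Idm C Z" p] E_morphism_emap[OF m, of c "Idm C X''"]
      types by simp
  have m1': "E_morphism C (X, f, Y, g, Z, d) (X'', s \<cdot> p', E, t, Z, Emap C (Idm C Z) p e)
      (p \<cdot> a, b\<^sub>1, Idm C Z)"
    unfolding E_morphism_iff[OF T(1) M]
    using types D1(10,11) inverses_cancel[OF p] E_morphism_emap[OF m1, of "Idm C Z" p] by simp
  have m2': "E_morphism C (X'', s \<cdot> p', E, t, Z, Emap C (Idm C Z) p e) (X'', f'', Y'', g'', Z'', d'')
      (Idm C X'', q \<cdot> b\<^sub>2, r \<cdot> c)"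
    unfolding E_morphism_iff[OF M T''(2)]
    using types D2(10,11) D(10,11) push_e comp_eq_comp[OF D2(10)] comp_eq_comp[OF D(10)]
      comp_eq_comp[OF D(11)] by simp
  have "E_triangle C (X, col C X Y X'' f (p \<cdot> a), dsum C Y X'', row C Y X'' E b\<^sub>1 (\<boxminus> (s \<cdot> p')), E,
      Emap C t (Idm C X) d)"
  proof (rule triangle_equiv[OF t1 inverses_diag[OF inverses_id[of Y] p, of Y X' Y X'']])
    show "col C X Y X'' f (p \<cdot> a) = diag_mor C Y X' Y X'' (Idm C Y) p \<cdot> col C X Y X' f a"
      by (rule into_dsum_eqI[of Y X'']) (use types in simp_all)
    show "row C Y X'' E b\<^sub>1 (\<boxminus> (s \<cdot> p')) \<cdot> diag_mor C Y X' Y X'' (Idm C Y) p =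
        row C Y X' E b\<^sub>1 (\<boxminus> s)"
      by (rule from_dsum_eqI[of Y X']) (use types in simp_all)
  qed (use types in simp_all)
  moreover have "E_triangle C (E, col C E Z Y'' (\<boxminus> t) (q \<cdot> b\<^sub>2), dsum C Z Y'',
      row C Z Y'' Z'' (r \<cdot> c) g'', Z'', Emap C (Idm C Z'') (s \<cdot> p') d'')"
  proof (rule triangle_iso[OF t2 inverses_id[of E] _ _ inverses_diag[OF inverses_id[of Z] q, of Z Y' Z Y''] _ _ r])
    show "diag_mor C Z Y' Z Y'' (Idm C Z) q \<cdot> col C E Z Y' (\<boxminus> t) b\<^sub>2 =
        col C E Z Y'' (\<boxminus> t) (q \<cdot> b\<^sub>2) \<cdot> Idm C E"
      by (rule into_dsum_eqI[of Z Y'']) (use types in simp_all)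
    show "row C Z Y'' Z'' (r \<cdot> c) g'' \<cdot> diag_mor C Z Y' Z Y'' (Idm C Z) q =
        r \<cdot> row C Z Y' Z' c g'"
      by (rule from_dsum_eqI[of Z Y']) (use types D(11) in simp_all)
    show "Emap C (Idm C Z') (Idm C E) (Emap C (Idm C Z') s d') =
        Emap C r (Idm C E) (Emap C (Idm C Z'') (s \<cdot> p') d'')"
      using E_morphism_emap[OF m, of "Idm C Z'" "s \<cdot> p'"] types by simp
  qed (use types in simp_all)
  ultimately have "homotopic C (X, f, Y, g, Z, d) (X'', f'', Y'', g'', Z'', d'')
      (p \<cdot> a, (q \<cdot> b\<^sub>2) \<cdot> b\<^sub>1, r \<cdot> c)"
    by (rule homotopicI[OF m1' m2'])
  then show ?thesis
    using types b by simp
qed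

text \<open>
  The intermediate triangle is \<open>X \<oplus> X' \<rightarrow> Y \<oplus> X' \<rightarrow> Z\<close>, the direct sum of \<open>T\<close> and \<open>X' = X' \<rightarrow> 0\<close>, with
  \<open>\<beta>\<^sub>1 = in\<^sub>1\<close> and \<open>\<beta>\<^sub>2 = 1 \<oplus> f'\<close>.  The triangle over \<open>Y \<oplus> (X \<oplus> X')\<close> is split; the one over
  \<open>Z \<oplus> (Y \<oplus> Y')\<close> is the direct sum of the split triangle \<open>Y \<rightarrow> Y \<oplus> Z \<rightarrow> Z\<close> and \<open>T'\<close>, up to a change of
  coordinates in the middle.
\<close>

lemma inclusion_homotopic:
  assumes T: "E_triangle C (X, f, Y, g, Z, d)" and T': "E_triangle C (X', f', Y', g', Z', d')"
  shows "homotopic C (X, f, Y, g, Z, d)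
    (dsum C X X', diag_mor C X X' Y Y' f f', dsum C Y Y',
     diag_mor C Y Y' Z Z' g g', dsum C Z Z', ext_sum C Z X d Z' X' d')
    (in1 (bip C X X'), in1 (bip C Y Y'), in1 (bip C Z Z'))"
    (is "homotopic C ?T (?X, ?f, ?Y, ?g, ?Z, ?d) _")
proof -
  note t = triangle_arr[OF T] triangle_arr[OF T']
  note S = triangle_sum[OF T T']
  let ?E = "dsum C Y X'"
  let ?s = "diag_mor C X X' Y X' f (Idm C X')"
  let ?t = "g \<cdot> pr1 (bip C Y X')"
  let ?e = "Emap C (Idm C Z) (in1 (bip C X X')) d"
  have M: "E_triangle C (?X, ?s, ?E, ?t, Z, ?e)"
  proof -
    \<comment> \<open>The zero third summand is removed by the isomorphism \<open>pr\<^sub>1\<close> from \<open>Z \<oplus> N\<close> to \<open>Z\<close>.\<close>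
    obtain N where N: "N \<in> Obj C" "Idm C N = zero N N" by (rule zero_object_obtain)
    have I: "E_triangle C (X', Idm C X', X', zero X' N, N, ext_zero N X')"
      by (rule split_triangle[where r = "Idm C X'" and i = "zero N X'"]) (use t N in simp_all)
    have "in1 (bip C Z N) \<cdot> pr1 (bip C Z N) = Idm C (dsum C Z N)"
      by (rule into_dsum_eqI[of Z N])
        (use t N to_zero[OF N(2), of "pr2 (bip C Z N)"] in simp_all)
    then have c: "inverses (pr1 (bip C Z N)) (in1 (bip C Z N))"
      using t N by (simp add: inverses_def)
    have sq: "?t \<cdot> Idm C ?E = pr1 (bip C Z N) \<cdot> diag_mor C Y X' Z N g (zero X' N)"
      using t N by simp
    show ?thesis
      by (rule triangle_iso[OF triangle_sum[OF T I] inverses_id[of ?X] _ _ inverses_id[of ?E] _ _ c])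
        (use t N sq in simp_all)
  qed
  have m1: "E_morphism C ?T (?X, ?s, ?E, ?t, Z, ?e) (in1 (bip C X X'), in1 (bip C Y X'), Idm C Z)"
    unfolding E_morphism_iff[OF T M] using t by simp
  have m2: "E_morphism C (?X, ?s, ?E, ?t, Z, ?e) (?X, ?f, ?Y, ?g, ?Z, ?d)
      (Idm C ?X, diag_mor C Y X' Y Y' (Idm C Y) f', in1 (bip C Z Z'))"
  proof -
    have 1: "diag_mor C Y X' Y Y' (Idm C Y) f' \<cdot> ?s = ?f \<cdot> Idm C ?X"
      by (rule into_dsum_eqI[of Y Y']) (use t in simp_all)
    have 2: "?g \<cdot> diag_mor C Y X' Y Y' (Idm C Y) f' = in1 (bip C Z Z') \<cdot> ?t"
      by (rule from_dsum_eqI[of Y X']) (use t triangle_comp_zero[OF T'] in simp_all)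
    show ?thesis
      unfolding E_morphism_iff[OF M S] using t 1 2 by simp
  qed
  have t1: "E_triangle C (X, col C X Y ?X f (in1 (bip C X X')), dsum C Y ?X,
      row C Y ?X ?E (in1 (bip C Y X')) (\<boxminus> ?s), ?E, Emap C ?t (Idm C X) d)"
  proof -
    \<comment> \<open>Since \<open>\<alpha> = in\<^sub>1\<close> has the retraction \<open>pr\<^sub>1\<close>, so has the first map; the section of the second
      map is \<open>(y, x') \<mapsto> (y, (0, -x'))\<close>.\<close>
    let ?r = "pr1 (bip C X X') \<cdot> pr2 (bip C Y ?X)"
    let ?i = "diag_mor C Y X' Y ?X (Idm C Y) (\<boxminus> in2 (bip C X X'))"
    let ?k = "col C X Y ?X f (in1 (bip C X X'))"
    let ?l = "row C Y ?X ?E (in1 (bip C Y X')) (\<boxminus> ?s)"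
    have li: "?l \<cdot> ?i = Idm C ?E"
      by (rule from_dsum_eqI[of Y X']) (use t in simp_all)
    have ri: "?r \<cdot> ?i = zero ?E X"
      by (rule from_dsum_eqI[of Y X']) (use t in simp_all)
    have lk: "?l \<cdot> ?k = zero X ?E"
      using t by simp
    have kr: "?k \<cdot> ?r \<boxplus> ?i \<cdot> ?l = Idm C (dsum C Y ?X)"
    proof (rule into_dsum_eqI[of Y ?X])
      show "pr1 (bip C Y ?X) \<cdot> (?k \<cdot> ?r \<boxplus> ?i \<cdot> ?l) = pr1 (bip C Y ?X) \<cdot> Idm C (dsum C Y ?X)"
        by (rule from_dsum_eqI[of Y ?X]) (use t in simp_all)
      show "pr2 (bip C Y ?X) \<cdot> (?k \<cdot> ?r \<boxplus> ?i \<cdot> ?l) = pr2 (bip C Y ?X) \<cdot> Idm C (dsum C Y ?X)"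
        by (rule from_dsum_eqI[of Y ?X]) (use t dsum_id in simp_all)
    qed (use t in simp_all)
    have "E_triangle C (X, ?k, dsum C Y ?X, ?l, ?E, ext_zero ?E X)"
      by (rule split_triangle[where r = ?r and i = ?i]) (use t li ri lk kr in simp_all)
    then show ?thesis
      using emap_deflation[OF T, of "pr1 (bip C Y X')" "Idm C X"] t by simp
  qed
  have t2: "E_triangle C (?E, col C ?E Z ?Y (\<boxminus> ?t) (diag_mor C Y X' Y Y' (Idm C Y) f'), dsum C Z ?Y,
      row C Z ?Y ?Z (in1 (bip C Z Z')) ?g, ?Z, Emap C (Idm C ?Z) ?s ?d)"
  proof -
    \<comment> \<open>The change of coordinates \<open>((y, z), y') \<mapsto> (z - g y, (y, y'))\<close> and its inverse.\<close>
    let ?W = "dsum C (dsum C Y Z) Y'" and ?V = "dsum C Z ?Y"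
    let ?b = "col C ?W Z ?Y
      ((pr2 (bip C Y Z) \<boxplus> \<boxminus> (g \<cdot> pr1 (bip C Y Z))) \<cdot> pr1 (bip C (dsum C Y Z) Y'))
      (diag_mor C (dsum C Y Z) Y' Y Y' (pr1 (bip C Y Z)) (Idm C Y'))"
    let ?y = "pr1 (bip C Y Y') \<cdot> pr2 (bip C Z ?Y)"
    let ?b' = "col C ?V (dsum C Y Z) Y'
      (col C ?V Y Z ?y (pr1 (bip C Z ?Y) \<boxplus> g \<cdot> ?y)) (pr2 (bip C Y Y') \<cdot> pr2 (bip C Z ?Y))"
    let ?k = "col C ?E Z ?Y (\<boxminus> ?t) (diag_mor C Y X' Y Y' (Idm C Y) f')"
    have "?b' \<cdot> ?b = Idm C ?W"
    proof (rule into_dsum_eqI[of "dsum C Y Z" Y'])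
      show "pr1 (bip C (dsum C Y Z) Y') \<cdot> (?b' \<cdot> ?b) = pr1 (bip C (dsum C Y Z) Y') \<cdot> Idm C ?W"
        by (rule into_dsum_eqI[of Y Z]) (use t in \<open>simp_all add: add_ac\<close>)
    qed (use t in simp_all)
    moreover have "?b \<cdot> ?b' = Idm C ?V"
    proof (rule into_dsum_eqI[of Z ?Y])
      show "pr2 (bip C Z ?Y) \<cdot> (?b \<cdot> ?b') = pr2 (bip C Z ?Y) \<cdot> Idm C ?V"
        by (rule into_dsum_eqI[of Y Y']) (use t in simp_all)
    qed (use t in \<open>simp_all add: add_ac\<close>)
    ultimately have b: "inverses ?b ?b'"
      using t by (simp add: inverses_def)
    have k: "?k = ?b \<cdot> diag_mor C Y X' (dsum C Y Z) Y' (in1 (bip C Y Z)) f'"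
    proof (rule into_dsum_eqI[of Z ?Y])
      show "pr2 (bip C Z ?Y) \<cdot> ?k =
          pr2 (bip C Z ?Y) \<cdot> (?b \<cdot> diag_mor C Y X' (dsum C Y Z) Y' (in1 (bip C Y Z)) f')"
        by (rule into_dsum_eqI[of Y Y']) (use t in simp_all)
    qed (use t in simp_all)
    have l: "row C Z ?Y ?Z (in1 (bip C Z Z')) ?g \<cdot> ?b =
        diag_mor C (dsum C Y Z) Y' Z Z' (pr2 (bip C Y Z)) g'"
      by (rule into_dsum_eqI[of Z Z']) (use t in \<open>simp_all add: add_ac\<close>)
    have "E_triangle C (?E, ?k, dsum C Z ?Y, row C Z ?Y ?Z (in1 (bip C Z Z')) ?g, ?Z,
        ext_sum C Z Y (ext_zero Z Y) Z' X' d')"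
      by (rule triangle_equiv[OF triangle_sum[OF zero_triangle[of Y Z] T'] b _ _ k _ _ l])
        (use t in simp_all)
    moreover have "Emap C (Idm C ?Z) ?s ?d = ext_sum C Z Y (ext_zero Z Y) Z' X' d'"
      using t emap_inflation[OF T, of "pr1 (bip C Z Z')" "in1 (bip C Y X')"]
      by (simp add: ext_sum_def)
    ultimately show ?thesis
      by simp
  qed
  show ?thesis
    using homotopicI[OF m1 m2 t1 t2] t by simp
qed


text \<open>
  The intermediate triangle is \<open>X' \<rightarrow> Z \<oplus> Y' \<rightarrow> Z \<oplus> Z'\<close>, the direct sum of \<open>0 \<rightarrow> Z = Z\<close> and \<open>T'\<close>, with
  \<open>\<beta>\<^sub>1 = g \<oplus> 1\<close> and \<open>\<beta>\<^sub>2 = pr\<^sub>2\<close>.  The triangle over \<open>(Y \<oplus> Y') \<oplus> X'\<close> is the direct sum of \<open>T\<close> and the split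
  triangle \<open>X' \<rightarrow> X' \<oplus> Y' \<rightarrow> Y'\<close>, up to a change of coordinates in the middle; the one over
  \<open>(Z \<oplus> Z') \<oplus> Y'\<close> is split.
\<close>

lemma projection_homotopic:
  assumes T: "E_triangle C (X, f, Y, g, Z, d)" and T': "E_triangle C (X', f', Y', g', Z', d')"
  shows "homotopic C
    (dsum C X X', diag_mor C X X' Y Y' f f', dsum C Y Y',
     diag_mor C Y Y' Z Z' g g', dsum C Z Z', ext_sum C Z X d Z' X' d')
    (X', f', Y', g', Z', d')
    (pr2 (bip C X X'), pr2 (bip C Y Y'), pr2 (bip C Z Z'))"
    (is "homotopic C (?X, ?f, ?Y, ?g, ?Z, ?d) ?T' _")
proof -
  note t = triangle_arr[OF T] triangle_arr[OF T']
  note S = triangle_sum[OF T T']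
  let ?E = "dsum C Z Y'"
  let ?s = "in2 (bip C Z Y') \<cdot> f'"
  let ?t = "diag_mor C Z Y' Z Z' (Idm C Z) g'"
  let ?e = "Emap C (pr2 (bip C Z Z')) (Idm C X') d'"
  let ?b1 = "diag_mor C Y Y' Z Y' g (Idm C Y')"
  have M: "E_triangle C (X', ?s, ?E, ?t, ?Z, ?e)"
  proof -
    \<comment> \<open>The zero first summand is removed by the isomorphism \<open>pr\<^sub>2\<close> from \<open>N \<oplus> X'\<close> to \<open>X'\<close>.\<close>
    obtain N where N: "N \<in> Obj C" "Idm C N = zero N N" by (rule zero_object_obtain)
    have I: "E_triangle C (N, zero N Z, Z, Idm C Z, Z, ext_zero Z N)"
      by (rule split_triangle[where r = "zero Z N" and i = "Idm C Z"]) (use t N in simp_all)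
    have "in2 (bip C N X') \<cdot> pr2 (bip C N X') = Idm C (dsum C N X')"
      by (rule into_dsum_eqI[of N X'])
        (use t N to_zero[OF N(2), of "pr1 (bip C N X')"] in simp_all)
    then have a: "inverses (pr2 (bip C N X')) (in2 (bip C N X'))"
      using t N by (simp add: inverses_def)
    have sq: "Idm C ?E \<cdot> diag_mor C N X' Z Y' (zero N Z) f' = ?s \<cdot> pr2 (bip C N X')"
      by (rule into_dsum_eqI[of Z Y']) (use t N in simp_all)
    show ?thesis
      by (rule triangle_iso[OF triangle_sum[OF I T'] a _ _ inverses_id[of ?E] _ _ inverses_id[of ?Z]])
        (use t N sq in simp_all)
  qed
  have m1: "E_morphism C (?X, ?f, ?Y, ?g, ?Z, ?d) (X', ?s, ?E, ?t, ?Z, ?e)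
      (pr2 (bip C X X'), ?b1, Idm C ?Z)"
  proof -
    have 1: "?b1 \<cdot> ?f = ?s \<cdot> pr2 (bip C X X')"
      by (rule into_dsum_eqI[of Z Y']) (use t comp_eq_comp[OF triangle_comp_zero[OF T]] in simp_all)
    have 2: "?t \<cdot> ?b1 = Idm C ?Z \<cdot> ?g"
      by (rule into_dsum_eqI[of Z Z']) (use t in simp_all)
    show ?thesis
      unfolding E_morphism_iff[OF S M] using t 1 2 by simp
  qed
  have m2: "E_morphism C (X', ?s, ?E, ?t, ?Z, ?e) ?T'
      (Idm C X', pr2 (bip C Z Y'), pr2 (bip C Z Z'))"
    unfolding E_morphism_iff[OF M T'] using t by simp
  have t1: "E_triangle C (?X, col C ?X ?Y X' ?f (pr2 (bip C X X')), dsum C ?Y X',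
      row C ?Y X' ?E ?b1 (\<boxminus> ?s), ?E, Emap C ?t (Idm C ?X) ?d)"
  proof -
    \<comment> \<open>The change of coordinates \<open>(y, (x', y')) \<mapsto> ((y, f' x' + y'), x')\<close> and its inverse.\<close>
    let ?W = "dsum C Y (dsum C X' Y')" and ?V = "dsum C ?Y X'"
    let ?b = "col C ?W ?Y X'
      (diag_mor C Y (dsum C X' Y') Y Y' (Idm C Y) (f' \<cdot> pr1 (bip C X' Y') \<boxplus> pr2 (bip C X' Y')))
      (pr1 (bip C X' Y') \<cdot> pr2 (bip C Y (dsum C X' Y')))"
    let ?b' = "col C ?V Y (dsum C X' Y') (pr1 (bip C Y Y') \<cdot> pr1 (bip C ?Y X'))
      (col C ?V X' Y' (pr2 (bip C ?Y X'))
        (pr2 (bip C Y Y') \<cdot> pr1 (bip C ?Y X') \<boxplus> \<boxminus> (f' \<cdot> pr2 (bip C ?Y X'))))"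
    let ?k = "col C ?X ?Y X' ?f (pr2 (bip C X X'))"
    let ?D = "diag_mor C X X' Y (dsum C X' Y') f (in1 (bip C X' Y'))"
    have "?b' \<cdot> ?b = Idm C ?W"
    proof (rule into_dsum_eqI[of Y "dsum C X' Y'"])
      show "pr2 (bip C Y (dsum C X' Y')) \<cdot> (?b' \<cdot> ?b) = pr2 (bip C Y (dsum C X' Y')) \<cdot> Idm C ?W"
        by (rule into_dsum_eqI[of X' Y']) (use t in \<open>simp_all add: add_ac\<close>)
    qed (use t in simp_all)
    moreover have "?b \<cdot> ?b' = Idm C ?V"
    proof (rule into_dsum_eqI[of ?Y X'])
      show "pr1 (bip C ?Y X') \<cdot> (?b \<cdot> ?b') = pr1 (bip C ?Y X') \<cdot> Idm C ?V"
        by (rule into_dsum_eqI[of Y Y']) (use t in \<open>simp_all add: add_ac\<close>)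
    qed (use t in simp_all)
    ultimately have b: "inverses ?b ?b'"
      using t by (simp add: inverses_def)
    have k: "?k = ?b \<cdot> ?D"
    proof (rule into_dsum_eqI[of ?Y X'])
      show "pr1 (bip C ?Y X') \<cdot> ?k = pr1 (bip C ?Y X') \<cdot> (?b \<cdot> ?D)"
        by (rule into_dsum_eqI[of Y Y']) (use t in simp_all)
    qed (use t in simp_all)
    have l: "row C ?Y X' ?E ?b1 (\<boxminus> ?s) \<cdot> ?b = diag_mor C Y (dsum C X' Y') Z Y' g (pr2 (bip C X' Y'))"
      by (rule into_dsum_eqI[of Z Y']) (use t in \<open>simp_all add: add_ac\<close>)
    have "E_triangle C (?X, ?k, ?V, row C ?Y X' ?E ?b1 (\<boxminus> ?s), ?E,
        ext_sum C Z X d Y' X' (ext_zero Y' X'))"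
      by (rule triangle_equiv[OF triangle_sum[OF T zero_triangle[of X' Y']] b _ _ k _ _ l])
        (use t in simp_all)
    moreover have "Emap C ?t (Idm C ?X) ?d = ext_sum C Z X d Y' X' (ext_zero Y' X')"
      using t emap_deflation[OF T', of "pr2 (bip C Z Y')" "in2 (bip C X X')"]
      by (simp add: ext_sum_def)
    ultimately show ?thesis
      by simp
  qed
  have t2: "E_triangle C (?E, col C ?E ?Z Y' (\<boxminus> ?t) (pr2 (bip C Z Y')), dsum C ?Z Y',
      row C ?Z Y' Z' (pr2 (bip C Z Z')) g', Z', Emap C (Idm C Z') ?s d')"
  proof -
    \<comment> \<open>The splitting is given by \<open>((z, z'), y') \<mapsto> (-z, y')\<close> and \<open>z' \<mapsto> ((0, z'), 0)\<close>.\<close>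
    let ?k = "col C ?E ?Z Y' (\<boxminus> ?t) (pr2 (bip C Z Y'))"
    let ?l = "row C ?Z Y' Z' (pr2 (bip C Z Z')) g'"
    let ?r = "diag_mor C ?Z Y' Z Y' (\<boxminus> pr1 (bip C Z Z')) (Idm C Y')"
    let ?i = "in1 (bip C ?Z Y') \<cdot> in2 (bip C Z Z')"
    have rk: "?r \<cdot> ?k = Idm C ?E"
      by (rule into_dsum_eqI[of Z Y']) (use t in simp_all)
    have ri: "?r \<cdot> ?i = zero Z' ?E"
      by (rule into_dsum_eqI[of Z Y']) (use t in simp_all)
    have lk: "?l \<cdot> ?k = zero ?E Z'"
      using t by simp
    have kr: "?k \<cdot> ?r \<boxplus> ?i \<cdot> ?l = Idm C (dsum C ?Z Y')"
    proof (rule from_dsum_eqI[of ?Z Y'])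
      show "(?k \<cdot> ?r \<boxplus> ?i \<cdot> ?l) \<cdot> in1 (bip C ?Z Y') = Idm C (dsum C ?Z Y') \<cdot> in1 (bip C ?Z Y')"
      proof (rule into_dsum_eqI[of ?Z Y'])
        show "pr1 (bip C ?Z Y') \<cdot> ((?k \<cdot> ?r \<boxplus> ?i \<cdot> ?l) \<cdot> in1 (bip C ?Z Y')) =
            pr1 (bip C ?Z Y') \<cdot> (Idm C (dsum C ?Z Y') \<cdot> in1 (bip C ?Z Y'))"
          by (rule into_dsum_eqI[of Z Z']) (use t in simp_all)
      qed (use t in simp_all)
      show "(?k \<cdot> ?r \<boxplus> ?i \<cdot> ?l) \<cdot> in2 (bip C ?Z Y') = Idm C (dsum C ?Z Y') \<cdot> in2 (bip C ?Z Y')"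
      proof (rule into_dsum_eqI[of ?Z Y'])
        show "pr1 (bip C ?Z Y') \<cdot> ((?k \<cdot> ?r \<boxplus> ?i \<cdot> ?l) \<cdot> in2 (bip C ?Z Y')) =
            pr1 (bip C ?Z Y') \<cdot> (Idm C (dsum C ?Z Y') \<cdot> in2 (bip C ?Z Y'))"
          by (rule into_dsum_eqI[of Z Z']) (use t in simp_all)
      qed (use t in simp_all)
    qed (use t in simp_all)
    have "E_triangle C (?E, ?k, dsum C ?Z Y', ?l, Z', ext_zero Z' ?E)"
      by (rule split_triangle[where r = ?r and i = ?i]) (use t rk ri lk kr in simp_all)
    then show ?thesis
      using emap_inflation[OF T', of "Idm C Z'" "in2 (bip C Z Y')"] t by simp
  qed
  show ?thesis
    using homotopicI[OF m1 m2 t1 t2] t by simp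
qed

text \<open>
  The lower triangular matrix with identities on the diagonal and the entry \<open>a\<close> below it differs
  from the identity by a morphism of square zero.
\<close>

lemma shear_inverses:
  assumes "arr a"
  shows "inverses
    (Idm C (dsum C (src a) (tgt a)) \<boxplus> in2 (bip C (src a) (tgt a)) \<cdot> (a \<cdot> pr1 (bip C (src a) (tgt a))))
    (Idm C (dsum C (src a) (tgt a)) \<boxplus>
      \<boxminus> (in2 (bip C (src a) (tgt a)) \<cdot> (a \<cdot> pr1 (bip C (src a) (tgt a)))))"
  by (rule unipotent_inverses) (use assms in simp_all)

lemma E_morphism_factorization:
  assumes m: "E_morphism C (X, f, Y, g, Z, d) (X', f', Y', g', Z', d') (a, b, c)"
  shows "\<exists>T \<phi>\<^sub>1 \<phi>\<^sub>2. homotopic C (X, f, Y, g, Z, d) T \<phi>\<^sub>1 \<and>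
    homotopic C T (X', f', Y', g', Z', d') \<phi>\<^sub>2 \<and> (a, b, c) = E_comp C \<phi>\<^sub>2 \<phi>\<^sub>1"
proof -
  note T = E_morphism_triangles(1)[OF m] and T' = E_morphism_triangles(2)[OF m]
  note t = triangle_arr[OF T] triangle_arr[OF T'] and D = E_morphismD[OF m]
  note S = triangle_sum[OF T T']
  let ?S = "(dsum C X X', diag_mor C X X' Y Y' f f', dsum C Y Y',
     diag_mor C Y Y' Z Z' g g', dsum C Z Z', ext_sum C Z X d Z' X' d')"
  let ?shear = "\<lambda>A B h. Idm C (dsum C A B) \<boxplus> in2 (bip C A B) \<cdot> (h \<cdot> pr1 (bip C A B))"
  have "E_morphism C ?S ?S (?shear X X' a, ?shear Y Y' b, ?shear Z Z' c)"
  proof -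
    have 1: "?shear Y Y' b \<cdot> diag_mor C X X' Y Y' f f' = diag_mor C X X' Y Y' f f' \<cdot> ?shear X X' a"
      using t D(1-9) comp_eq_comp[OF D(10)] by simp
    have 2: "diag_mor C Y Y' Z Z' g g' \<cdot> ?shear Y Y' b = ?shear Z Z' c \<cdot> diag_mor C Y Y' Z Z' g g'"
      using t D(1-9) comp_eq_comp[OF D(11)] by simp
    have 3: "Emap C (Idm C (dsum C Z Z')) (?shear X X' a) (ext_sum C Z X d Z' X' d') =
        Emap C (?shear Z Z' c) (Idm C (dsum C X X')) (ext_sum C Z X d Z' X' d')"
    proof -
      interpret E: comm_group "Ext C (dsum C Z Z') (dsum C X X')"
        using t by (intro ext_group) simp_all
      show ?thesis
        using t D(1-9) E_morphism_emap[OF m, of "pr1 (bip C Z Z')" "in2 (bip C X X')"]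
        by (simp add: E.m_ac)
    qed
    show ?thesis
      unfolding E_morphism_iff[OF S S] using t D(1-9) 1 2 3 by simp
  qed
  then have "homotopic C (X, f, Y, g, Z, d) ?S (?shear X X' a \<cdot> in1 (bip C X X'),
      ?shear Y Y' b \<cdot> in1 (bip C Y Y'), ?shear Z Z' c \<cdot> in1 (bip C Z Z'))"
    using shear_inverses[of a] shear_inverses[of b] shear_inverses[of c] D(1-9)
    by (intro homotopic_iso[OF inclusion_homotopic[OF T T']]) auto
  moreover have "(a, b, c) = E_comp C (pr2 (bip C X X'), pr2 (bip C Y Y'), pr2 (bip C Z Z'))
     (?shear X X' a \<cdot> in1 (bip C X X'), ?shear Y Y' b \<cdot> in1 (bip C Y Y'), ?shear Z Z' c \<cdot> in1 (bip C Z Z'))"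
    using t D(1-9) by simp
  ultimately show ?thesis
    using projection_homotopic[OF T T'] by blast
qed

end

theorem proposition3p8:
  fixes C :: "('o, 'm, 'e) extri"
    and T T' :: "('o, 'm, 'e) tri"
    and \<phi> :: "'m \<times> 'm \<times> 'm"
  assumes "extriangulated_category C"
    and "E_morphism C T T' \<phi>"
  shows "\<exists>T'' \<phi>\<^sub>1 \<phi>\<^sub>2.
           homotopic C T T'' \<phi>\<^sub>1 \<and> homotopic C T'' T' \<phi>\<^sub>2 \<and> \<phi> = E_comp C \<phi>\<^sub>2 \<phi>\<^sub>1"
proof -
  interpret extriangulated_category C by (rule assms(1))
  show ?thesis
    using assms(2) E_morphism_factorization by (cases T, cases T', cases \<phi>) blast
qed

end
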